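(* Let $G$ be any connected graph and let $U\subseteq V(G)$ be any vertex set. Then exactly one of the following two assertions holds: (i) $G$ contains a star attached to $U$; (ii) there is a locally finite normal tree $T\subseteq G$ that contains $U$ (that is, $U\subseteq V(T)$) and all whose rays are undominated in $G$. Moreover, the normal tree $T$ in (ii) can be chosen such that it contains $U$ cofinally and every component of $G-T$ has finite neighbourhood.
   Context: Graphs may be infinite. A ray is a one-way infinite path. A star attached to $U$ is a subdivided infinite star (a subdivision of a star with infinitely many leaves) contained in $G$ with all its leaves in $U$. A vertex $v$ of $G$ dominates a ray $R\subseteq G$ if there is an infinite $v$--$(R-v)$ fan in $G$, i.e. infinitely many paths from $v$ to $R-v$ that pairwise meet only in $v$; a ray is undominated in $G$ if no vertex of $G$ dominates it. A rooted tree $T$ with root $r$ carries the tree-order: $x\le y$ if $x\in rTy$. A rooted tree $T\subseteq G$ (not necessarily spanning) is normal in $G$ if the endvertices of every $T$-path in $G$ are comparable in the tree-order of $T$, where a $T$-path is a non-trivial path in $G$ whose endvertices but no inner vertices lie in $T$. A tree is locally finite if all its vertices have finite degree. A rooted tree $T\subseteq G$ contains a vertex set $W$ cofinally if $W\subseteq V(T)$ and for every $t\in V(T)$ there is $w\in W$ with $w\ge t$ in the tree-order of $T$. The neighbourhood of a component $C$ of $G-T$ is the set of vertices outside $C$ (hence in $T$) that have a neighbour in $C$.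
   Formalization: The claim that T can be chosen to contain U cofinally is stated only for nonempty U, since a rooted tree has a root and so never contains the empty set cofinally; everything else is stated for all U. *)

theory Defs
  imports Main
begin

section \<open>Graphs, paths and rays\<close>

datatype 'a ugraph = Graph (vertices: "'a set") (edges: "'a set set")

definition simple_graph :: "'a ugraph \<Rightarrow> bool" where
  "simple_graph G \<longleftrightarrow>
     (\<forall>e\<in>edges G. \<exists>u\<in>vertices G. \<exists>v\<in>vertices G. u \<noteq> v \<and> e = {u, v})"

definition is_subgraph :: "'a ugraph \<Rightarrow> 'a ugraph \<Rightarrow> bool" where
  "is_subgraph H G \<longleftrightarrow>
     simple_graph H \<and> vertices H \<subseteq> vertices G \<and> edges H \<subseteq> edges G"

definition nbhd :: "'a ugraph \<Rightarrow> 'a \<Rightarrow> 'a set" where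
  "nbhd G v = {u. {v, u} \<in> edges G}"

definition delete_vertices :: "'a ugraph \<Rightarrow> 'a set \<Rightarrow> 'a ugraph" where
  "delete_vertices G X = Graph (vertices G - X) {e \<in> edges G. e \<inter> X = {}}"

text \<open>A finite path is the nonempty list of its vertices in order; a one-element list is a
  trivial path.\<close>

definition path_in :: "'a ugraph \<Rightarrow> 'a list \<Rightarrow> bool" where
  "path_in G p \<longleftrightarrow> p \<noteq> [] \<and> distinct p \<and> set p \<subseteq> vertices G \<and>
     (\<forall>i. Suc i < length p \<longrightarrow> {p ! i, p ! Suc i} \<in> edges G)"

definition inner_vertices :: "'a list \<Rightarrow> 'a set" where
  "inner_vertices p = set (butlast (tl p))"

definition path_edges :: "'a list \<Rightarrow> 'a set set" where
  "path_edges p = {{p ! i, p ! Suc i} | i. Suc i < length p}"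

definition connected_graph :: "'a ugraph \<Rightarrow> bool" where
  "connected_graph G \<longleftrightarrow> vertices G \<noteq> {} \<and>
     (\<forall>u\<in>vertices G. \<forall>v\<in>vertices G. \<exists>p. path_in G p \<and> hd p = u \<and> last p = v)"

definition is_component :: "'a ugraph \<Rightarrow> 'a ugraph \<Rightarrow> bool" where
  "is_component C G \<longleftrightarrow> is_subgraph C G \<and> connected_graph C \<and>
     (\<forall>D. is_subgraph D G \<and> connected_graph D \<and> is_subgraph C D \<longrightarrow> D = C)"

definition neighbourhood :: "'a ugraph \<Rightarrow> 'a ugraph \<Rightarrow> 'a set" where
  "neighbourhood G C = {v \<in> vertices G - vertices C. \<exists>u\<in>vertices C. {v, u} \<in> edges G}"

text \<open>A ray is given by the enumeration of its vertices starting at its first vertex.\<close>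

definition ray_in :: "'a ugraph \<Rightarrow> (nat \<Rightarrow> 'a) \<Rightarrow> bool" where
  "ray_in G R \<longleftrightarrow> inj R \<and> range R \<subseteq> vertices G \<and> (\<forall>n. {R n, R (Suc n)} \<in> edges G)"


section \<open>Stars attached to a set\<close>

definition infinite_star :: "'a ugraph \<Rightarrow> bool" where
  "infinite_star H \<longleftrightarrow> infinite (vertices H) \<and>
     (\<exists>c\<in>vertices H. edges H = {{c, v} | v. v \<in> vertices H - {c}})"

text \<open>\<open>S\<close> arises from \<open>H\<close> by replacing the edges \<open>e\<close> of \<open>H\<close> by independent paths \<open>P e\<close> between
  their endvertices; the vertices of \<open>H\<close> are themselves the branch vertices of \<open>S\<close>.\<close>

definition is_subdivision :: "'a ugraph \<Rightarrow> 'a ugraph \<Rightarrow> bool" where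
  "is_subdivision S H \<longleftrightarrow> (\<exists>P.
     (\<forall>e\<in>edges H. path_in S (P e) \<and> {hd (P e), last (P e)} = e \<and>
        inner_vertices (P e) \<inter> vertices H = {}) \<and>
     (\<forall>e\<in>edges H. \<forall>f\<in>edges H. e \<noteq> f \<longrightarrow>
        inner_vertices (P e) \<inter> inner_vertices (P f) = {}) \<and>
     vertices S = vertices H \<union> (\<Union>e\<in>edges H. set (P e)) \<and>
     edges S = (\<Union>e\<in>edges H. path_edges (P e)))"

definition leaves :: "'a ugraph \<Rightarrow> 'a set" where
  "leaves S = {v \<in> vertices S. card (nbhd S v) = 1}"

definition has_star_attached_to :: "'a ugraph \<Rightarrow> 'a set \<Rightarrow> bool" where
  "has_star_attached_to G U \<longleftrightarrow>
     (\<exists>H S. infinite_star H \<and> is_subdivision S H \<and> is_subgraph S G \<and> leaves S \<subseteq> U)"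


section \<open>Domination\<close>

definition is_fan :: "'a ugraph \<Rightarrow> 'a \<Rightarrow> 'a set \<Rightarrow> 'a list set \<Rightarrow> bool" where
  "is_fan G v B F \<longleftrightarrow>
     (\<forall>p\<in>F. path_in G p \<and> hd p = v \<and> set p \<inter> B = {last p}) \<and>
     (\<forall>p\<in>F. \<forall>q\<in>F. p \<noteq> q \<longrightarrow> set p \<inter> set q = {v})"

definition dominates :: "'a ugraph \<Rightarrow> 'a \<Rightarrow> (nat \<Rightarrow> 'a) \<Rightarrow> bool" where
  "dominates G v R \<longleftrightarrow> v \<in> vertices G \<and> (\<exists>F. infinite F \<and> is_fan G v (range R - {v}) F)"

definition undominated :: "'a ugraph \<Rightarrow> (nat \<Rightarrow> 'a) \<Rightarrow> bool" where
  "undominated G R \<longleftrightarrow> \<not> (\<exists>v. dominates G v R)"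


section \<open>Rooted and normal trees\<close>

definition is_cycle :: "'a ugraph \<Rightarrow> 'a list \<Rightarrow> bool" where
  "is_cycle G c \<longleftrightarrow> path_in G c \<and> 3 \<le> length c \<and> {last c, hd c} \<in> edges G"

definition is_tree :: "'a ugraph \<Rightarrow> bool" where
  "is_tree T \<longleftrightarrow> simple_graph T \<and> connected_graph T \<and> \<not> (\<exists>c. is_cycle T c)"

definition is_rooted_tree :: "'a ugraph \<Rightarrow> 'a \<Rightarrow> bool" where
  "is_rooted_tree T r \<longleftrightarrow> is_tree T \<and> r \<in> vertices T"

definition tree_le :: "'a ugraph \<Rightarrow> 'a \<Rightarrow> 'a \<Rightarrow> 'a \<Rightarrow> bool" where
  "tree_le T r x y \<longleftrightarrow> (\<exists>p. path_in T p \<and> hd p = r \<and> last p = y \<and> x \<in> set p)"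

text \<open>\<open>X_path G X p\<close>, for \<open>X\<close> the vertex set of a subgraph \<open>T\<close> of \<open>G\<close>: \<open>p\<close> is a \<open>T\<close>-path in \<open>G\<close>.\<close>

definition X_path :: "'a ugraph \<Rightarrow> 'a set \<Rightarrow> 'a list \<Rightarrow> bool" where
  "X_path G X p \<longleftrightarrow> path_in G p \<and> 2 \<le> length p \<and> hd p \<in> X \<and> last p \<in> X \<and>
     inner_vertices p \<inter> X = {}"

definition normal_tree_in :: "'a ugraph \<Rightarrow> 'a ugraph \<Rightarrow> 'a \<Rightarrow> bool" where
  "normal_tree_in G T r \<longleftrightarrow> is_rooted_tree T r \<and> is_subgraph T G \<and>
     (\<forall>p. X_path G (vertices T) p \<longrightarrow>
        tree_le T r (hd p) (last p) \<or> tree_le T r (last p) (hd p))"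

definition locally_finite :: "'a ugraph \<Rightarrow> bool" where
  "locally_finite T \<longleftrightarrow> (\<forall>v\<in>vertices T. finite (nbhd T v))"

definition contains_cofinally :: "'a ugraph \<Rightarrow> 'a \<Rightarrow> 'a set \<Rightarrow> bool" where
  "contains_cofinally T r W \<longleftrightarrow>
     W \<subseteq> vertices T \<and> (\<forall>t\<in>vertices T. \<exists>w\<in>W. tree_le T r t w)"

definition undominated_normal_tree :: "'a ugraph \<Rightarrow> 'a set \<Rightarrow> 'a ugraph \<Rightarrow> 'a \<Rightarrow> bool" where
  "undominated_normal_tree G U T r \<longleftrightarrow>
     normal_tree_in G T r \<and> locally_finite T \<and> U \<subseteq> vertices T \<and>
     (\<forall>R. ray_in T R \<longrightarrow> undominated G R)"

end

theory Submission
  imports Defs "HOL-Library.Countable_Set"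
begin

text \<open>
  Call \<open>v\<close> linked to \<open>B\<close> if no finite set avoiding \<open>v\<close> separates \<open>v\<close> from \<open>B - {v}\<close>, and \<open>B\<close> tied to
  \<open>U\<close> if every finite set \<open>X\<close> leaves all but finitely many vertices of \<open>B\<close> joined to \<open>U\<close> in \<open>G - X\<close>.
  A star attached to \<open>U\<close> is the same as a vertex linked to \<open>U\<close>, a vertex dominates a ray iff it
  is linked to it, and a vertex linked to a set that is tied to \<open>U\<close> is linked to \<open>U\<close>.

  If \<open>U\<close> lies in a locally finite tree \<open>T\<close>, then by Koenig's lemma \<open>T\<close> contains a ray all of whose
  vertices lie below infinitely many leaves of a given star attached to \<open>U\<close>; its centre dominates
  this ray. Conversely, suppose that no star is attached to \<open>U\<close>. Adding to \<open>U\<close> a maximal family of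
  disjoint rays tied to \<open>U\<close> yields a set \<open>W\<close> that is tied to \<open>U\<close>, hence countable, and such that the
  components of \<open>G - W\<close> have finite neighbourhoods. A depth-first construction that always heads for
  the next element of \<open>W\<close>, but only enters components meeting \<open>U\<close>, gives a normal tree \<open>T\<close> containing
  \<open>U\<close> cofinally. Cofinality makes every subset of \<open>T\<close> tied to \<open>U\<close>, so vertices of infinite degree
  and dominated rays would produce stars attached to \<open>U\<close>. If a component \<open>D\<close> of \<open>G - T\<close> had
  infinitely many neighbours, then \<open>D\<close> would avoid \<open>W\<close>, and the connected set from which the
  construction picked a sufficiently high neighbour of \<open>D\<close> would contain \<open>D\<close> but miss the finite
  neighbourhood of the component of \<open>G - W\<close> around \<open>D\<close>; so it would lie inside that component,
  although it meets \<open>U\<close>.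
\<close>

section \<open>Connectedness inside a vertex set\<close>

definition adj :: "'a set set \<Rightarrow> 'a set \<Rightarrow> ('a \<times> 'a) set" where
  "adj E A = {(a, b). {a, b} \<in> E \<and> a \<in> A \<and> b \<in> A}"

text \<open>Reachability by walks, which makes transitivity immediate; \<open>conn_imp_path\<close>
  leads back to paths. The conjunct \<open>a \<in> A\<close> excludes the empty walk at a vertex
  outside \<open>A\<close>.\<close>

definition conn :: "'a set set \<Rightarrow> 'a set \<Rightarrow> 'a \<Rightarrow> 'a \<Rightarrow> bool" where
  "conn E A a b \<longleftrightarrow> a \<in> A \<and> (a, b) \<in> (adj E A)\<^sup>*"

lemma conn_refl: "a \<in> A \<Longrightarrow> conn E A a a"
  by (simp add: conn_def)

lemma conn_right:
  assumes "conn E A a b"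
  shows "b \<in> A"
proof -
  have "(a, b) \<in> (adj E A)\<^sup>*" "a \<in> A" using assms by (auto simp: conn_def)
  then show ?thesis by (induction rule: rtrancl_induct) (auto simp: adj_def)
qed

lemma conn_trans: "conn E A a b \<Longrightarrow> conn E A b c \<Longrightarrow> conn E A a c"
  by (auto simp: conn_def)

lemma sym_adj: "sym (adj E A)"
  by (auto simp: sym_def adj_def insert_commute)

lemma conn_sym: "conn E A a b \<Longrightarrow> conn E A b a"
  using conn_right[of E A a b] sym_rtrancl[OF sym_adj[of E A]]
  by (auto simp: conn_def dest: symD)

lemma adj_mono: "A \<subseteq> B \<Longrightarrow> E \<subseteq> F \<Longrightarrow> adj E A \<subseteq> adj F B"
  by (auto simp: adj_def)

lemma conn_mono: "conn E A a b \<Longrightarrow> A \<subseteq> B \<Longrightarrow> E \<subseteq> F \<Longrightarrow> conn F B a b"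
  using rtrancl_mono[OF adj_mono[of A B E F]] by (auto simp: conn_def)

lemma conn_edge: "{a, b} \<in> E \<Longrightarrow> a \<in> A \<Longrightarrow> b \<in> A \<Longrightarrow> conn E A a b"
  by (auto simp: conn_def adj_def)

text \<open>Induction along the walk. This is the tool for trapping a connected set in a region
  \<open>S\<close> that no edge inside \<open>A\<close> leaves.\<close>

lemma conn_closed:
  assumes "conn E A a b" "a \<in> S"
    and "\<And>x y. x \<in> S \<Longrightarrow> x \<in> A \<Longrightarrow> y \<in> A \<Longrightarrow> {x, y} \<in> E \<Longrightarrow> y \<in> S"
  shows "b \<in> S"
proof -
  have "(a, b) \<in> (adj E A)\<^sup>*" using assms by (auto simp: conn_def)
  then show ?thesis using assms(2)
    by (induction rule: rtrancl_induct) (auto simp: adj_def intro: assms(3))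
qed

text \<open>Every vertex passed by the walk is itself reachable from \<open>a\<close>.\<close>

lemma conn_inside:
  assumes "conn E A a b"
  shows "conn E {x. conn E A a x} a b"
proof -
  have *: "(a, b) \<in> (adj E A)\<^sup>*" "a \<in> A" using assms by (auto simp: conn_def)
  then show ?thesis
  proof (induction rule: rtrancl_induct)
    case base
    then show ?case by (simp add: conn_refl)
  next
    case (step y z)
    have "conn E A a z" using step.hyps *(2) unfolding conn_def by (auto intro: rtrancl.rtrancl_into_rtrancl)
    moreover have "{y, z} \<in> E" using step.hyps by (auto simp: adj_def)
    ultimately show ?case using step.IH conn_right[OF step.IH] *(2)
      by (auto intro: conn_trans conn_edge)
  qed
qed

lemma edge_in_vertices:
  assumes "simple_graph G" "{a, b} \<in> edges G"
  shows "a \<in> vertices G" "b \<in> vertices G" "a \<noteq> b"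
  using assms unfolding simple_graph_def by (auto simp: doubleton_eq_iff)

lemma path_in_iff:
  "path_in G p \<longleftrightarrow> p \<noteq> [] \<and> distinct p \<and> set p \<subseteq> vertices G \<and>
     successively (\<lambda>x y. {x, y} \<in> edges G) p"
  unfolding path_in_def successively_conv_nth by auto

lemma path_in_prefix: "path_in G (xs @ ys) \<Longrightarrow> xs \<noteq> [] \<Longrightarrow> path_in G xs"
  by (auto simp: path_in_iff successively_append_iff)

text \<open>The path is grown along the walk; whenever the walk returns to it, the path is cut back
  to that vertex.\<close>

lemma conn_imp_path:
  assumes "simple_graph G" "a \<in> vertices G" "conn (edges G) A a b"
  shows "\<exists>p. path_in G p \<and> hd p = a \<and> last p = b \<and> set p \<subseteq> A"
proof -
  have "(a, b) \<in> (adj (edges G) A)\<^sup>*" "a \<in> A" using assms by (auto simp: conn_def)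
  then show ?thesis
  proof (induction rule: rtrancl_induct)
    case base
    then show ?case using assms by (intro exI[of _ "[a]"]) (auto simp: path_in_iff)
  next
    case (step y z)
    then obtain p where p: "path_in G p" "hd p = a" "last p = y" "set p \<subseteq> A" by blast
    have z: "{y, z} \<in> edges G" "z \<in> A" using step by (auto simp: adj_def)
    show ?case
    proof (cases "z \<in> set p")
      case True
      then obtain xs ys where xy: "p = (xs @ [z]) @ ys" by (auto simp: in_set_conv_decomp)
      have "path_in G (xs @ [z])" using path_in_prefix p(1) unfolding xy by blast
      moreover have "hd (xs @ [z]) = a" using p(2) unfolding xy by (cases xs) auto
      ultimately show ?thesis using p(4) xy by (intro exI[of _ "xs @ [z]"]) auto
    next
      case False
      have "path_in G (p @ [z])"
        using p z False edge_in_vertices[OF assms(1) z(1)]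
        by (auto simp: path_in_iff successively_append_iff)
      then show ?thesis using p z by (intro exI[of _ "p @ [z]"]) (auto simp: path_in_iff)
    qed
  qed
qed

lemma path_conn_hd:
  assumes "path_in G p" "set p \<subseteq> A" "x \<in> set p"
  shows "conn (edges G) A (hd p) x"
proof -
  have "p \<noteq> []" "successively (\<lambda>x y. {x, y} \<in> edges G) p" using assms by (auto simp: path_in_iff)
  then show ?thesis using assms(2,3)
  proof (induction p rule: list_nonempty_induct)
    case (single y)
    then show ?case by (auto intro: conn_refl)
  next
    case (cons y p)
    have yp: "{y, hd p} \<in> edges G" and s: "successively (\<lambda>x y. {x, y} \<in> edges G) p"
      using cons by (cases p; auto)+
    show ?case
    proof (cases "x = y")
      case True
      then show ?thesis using cons by (auto intro: conn_refl)
    next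
      case False
      then have "conn (edges G) A (hd p) x" using cons s by auto
      moreover have "conn (edges G) A y (hd p)"
        using yp cons by (intro conn_edge) auto
      ultimately show ?thesis by (auto intro: conn_trans)
    qed
  qed
qed

lemma path_conn:
  assumes "path_in G p" "set p \<subseteq> A" "x \<in> set p" "y \<in> set p"
  shows "conn (edges G) A x y"
  using assms path_conn_hd conn_sym conn_trans by metis

lemma connected_graph_conn:
  assumes "connected_graph G" "a \<in> vertices G" "b \<in> vertices G"
  shows "conn (edges G) (vertices G) a b"
proof -
  obtain p where p: "path_in G p" "hd p = a" "last p = b"
    using assms unfolding connected_graph_def by blast
  then show ?thesis using path_conn_hd[of G p "vertices G" b] by (auto simp: path_in_def)
qed

lemma inner_vertices_eq:
  assumes "distinct p" "2 \<le> length p"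
  shows "inner_vertices p = set p - {hd p, last p}"
proof -
  obtain a q where p: "p = a # q" "q \<noteq> []" using assms(2) by (cases p) (auto simp: Suc_le_eq)
  then obtain b q' where "q = q' @ [b]" by (metis rev_exhaust)
  then show ?thesis using p assms(1) by (auto simp: inner_vertices_def)
qed

section \<open>Fans, stars and domination\<close>

definition linked :: "'a ugraph \<Rightarrow> 'a \<Rightarrow> 'a set \<Rightarrow> bool" where
  "linked G v B \<longleftrightarrow> v \<in> vertices G \<and>
     (\<forall>X. finite X \<longrightarrow> v \<notin> X \<longrightarrow> (\<exists>b\<in>B - {v}. conn (edges G) (- X) v b))"

lemma linked_mono: "linked G v A \<Longrightarrow> A \<subseteq> B \<Longrightarrow> linked G v B"
  unfolding linked_def by blast

lemma finite_not_linked: "finite B \<Longrightarrow> \<not> linked G v B"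
proof
  assume "finite B" "linked G v B"
  then obtain b where "b \<in> B - {v}" "conn (edges G) (- (B - {v})) v b"
    unfolding linked_def by (meson DiffD2 finite_Diff singletonI)
  then show False using conn_right[of "edges G" "- (B - {v})" v b] by blast
qed

text \<open>Choosing a point of \<open>S p \<inter> X\<close> for each member meeting
  \<open>X\<close> is injective, because members share at most \<open>v\<close> and
  \<open>v \<notin> X\<close>; so only finitely many members meet \<open>X\<close>.\<close>

lemma disjoint_member:
  assumes "infinite F" "finite X" "v \<notin> X"
    and "\<And>p q. p \<in> F \<Longrightarrow> q \<in> F \<Longrightarrow> p \<noteq> q \<Longrightarrow> S p \<inter> S q \<subseteq> {v}"
  shows "\<exists>p\<in>F. S p \<inter> X = {}"
proof (rule ccontr)
  assume "\<not> ?thesis"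
  then have "\<forall>p\<in>F. \<exists>x. x \<in> S p \<inter> X" by blast
  then obtain h where h: "\<forall>p\<in>F. h p \<in> S p \<inter> X" by metis
  have "inj_on h F"
  proof (rule inj_onI, rule ccontr)
    fix p q assume pq: "p \<in> F" "q \<in> F" "h p = h q" "p \<noteq> q"
    then have "h p \<in> S p \<inter> S q" using h by (metis Int_iff)
    then show False using assms(4)[OF pq(1,2,4)] h pq(1) assms(3) by blast
  qed
  moreover have "finite (h ` F)" using h assms(2) by (auto intro: finite_subset[of _ X])
  ultimately show False using assms(1) finite_imageD by blast
qed

text \<open>Greedy choice: each path avoids all vertices other than \<open>v\<close> of the earlier
  ones, a finite set that cannot separate \<open>v\<close> from \<open>B - {v}\<close>.\<close>

lemma linked_fan:
  assumes G: "simple_graph G" and L: "linked G v B"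
  obtains p :: "nat \<Rightarrow> 'a list" where
    "\<And>n. path_in G (p n)" "\<And>n. hd (p n) = v" "\<And>n. set (p n) \<inter> (B - {v}) = {last (p n)}"
    "\<And>m n. m \<noteq> n \<Longrightarrow> set (p m) \<inter> set (p n) = {v}"
proof -
  have v: "v \<in> vertices G" using L by (simp add: linked_def)
  have ex: "\<exists>p. path_in G p \<and> hd p = v \<and> set p \<inter> (B - {v}) = {last p} \<and> set p \<inter> X = {}"
    if X: "finite X" "v \<notin> X" for X
  proof -
    obtain b where b: "b \<in> B - {v}" "conn (edges G) (- X) v b" using L X unfolding linked_def by blast
    obtain q where q: "path_in G q" "hd q = v" "last q = b" "set q \<subseteq> - X"
      using conn_imp_path[OF G v b(2)] by blast
    have "\<exists>x\<in>set q. x \<in> B - {v}" using q(1,3) b(1) by (auto simp: path_in_def)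
    \<comment> \<open>The path is cut at its first vertex in \<open>B - {v}\<close>, so that it
      meets this set only in its end.\<close>
    then obtain xs x ys where xy: "q = xs @ x # ys" "x \<in> B - {v}" "\<forall>y\<in>set xs. y \<notin> B - {v}"
      using split_list_first_prop[of q "\<lambda>x. x \<in> B - {v}"] by blast
    have "path_in G (xs @ [x])" using q(1) path_in_prefix[of G "xs @ [x]" ys] xy(1) by simp
    moreover have "hd (xs @ [x]) = v" using q(2) xy(1) by (cases xs) auto
    moreover have "set (xs @ [x]) \<inter> (B - {v}) = {last (xs @ [x])}" using xy(2,3) by auto
    moreover have "set (xs @ [x]) \<inter> X = {}" using q(4) xy(1) by auto
    ultimately show ?thesis by blast
  qed
  define P where "P X p \<longleftrightarrow> path_in G p \<and> hd p = v \<and> set p \<inter> (B - {v}) = {last p} \<and> set p \<inter> X = {}" for X p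
  define pick where "pick X = (SOME p. P X p)" for X
  have pick: "P X (pick X)" if "finite X" "v \<notin> X" for X
    unfolding pick_def by (rule someI_ex) (use ex[OF that] in \<open>auto simp: P_def\<close>)
  \<comment> \<open>\<open>S n\<close> collects the vertices of the first \<open>n\<close> paths,
    without \<open>v\<close> so that it remains an admissible separator.\<close>
  define S where "S = rec_nat {} (\<lambda>_ X. X \<union> (set (pick X) - {v}))"
  have S0: "S 0 = {}" and SS: "\<And>n. S (Suc n) = S n \<union> (set (pick (S n)) - {v})"
    by (auto simp: S_def)
  have fin: "finite (S n) \<and> v \<notin> S n" for n by (induction n) (auto simp: S0 SS)
  have Pn: "P (S n) (pick (S n))" for n using pick fin by blast
  have sub: "set (pick (S m)) - {v} \<subseteq> S n" if "m < n" for m n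
    using that by (induction n) (auto simp: SS less_Suc_eq)
  have mono: "set (pick (S m)) \<inter> set (pick (S n)) = {v}" if "m < n" for m n
  proof -
    have "v \<in> set (pick (S k))" for k
      using Pn[of k] hd_in_set[of "pick (S k)"] unfolding P_def path_in_def by simp
    then show ?thesis using sub[OF that] Pn[of n] unfolding P_def by blast
  qed
  show ?thesis
  proof (rule that[of "\<lambda>n. pick (S n)"])
    show "set (pick (S m)) \<inter> set (pick (S n)) = {v}" if "m \<noteq> n" for m n
      using mono[of m n] mono[of n m] that by (cases "m < n") (auto simp: Int_commute)
    show "path_in G (pick (S n))" "hd (pick (S n)) = v"
      "set (pick (S n)) \<inter> (B - {v}) = {last (pick (S n))}" for n
      using Pn[of n] by (simp_all add: P_def)
  qed
qed

lemma linked_imp_dominates: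
  assumes "simple_graph G" "linked G v (range R)"
  shows "dominates G v R"
proof -
  obtain p where p: "\<And>n. path_in G (p n)" "\<And>n::nat. hd (p n) = v"
    "\<And>n. set (p n) \<inter> (range R - {v}) = {last (p n)}"
    "\<And>m n. m \<noteq> n \<Longrightarrow> set (p m) \<inter> set (p n) = {v}"
    using linked_fan[OF assms] by blast
  have "inj p"
  proof (rule injI, rule ccontr)
    fix m n assume "p m = p n" "m \<noteq> n"
    then have "set (p n) = {v}" using p(4)[of m n] by auto
    then show False using p(3)[of n] by auto
  qed
  then have "infinite (range p)" using finite_imageD infinite_UNIV_nat by blast
  moreover have "is_fan G v (range R - {v}) (range p)"
    unfolding is_fan_def
  proof (intro conjI ballI impI)
    fix x y assume "x \<in> range p" "y \<in> range p" "x \<noteq> y"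
    then obtain m n where "x = p m" "y = p n" "m \<noteq> n" by blast
    then show "set x \<inter> set y = {v}" using p(4) by simp
  next
    fix x assume "x \<in> range p"
    then show "path_in G x" "hd x = v" "set x \<inter> (range R - {v}) = {last x}" using p(1-3) by blast+
  qed
  ultimately show ?thesis using assms(2) unfolding dominates_def linked_def by blast
qed

lemma dominates_imp_linked:
  assumes "dominates G v R"
  shows "linked G v (range R)"
  unfolding linked_def
proof (intro conjI allI impI)
  show "v \<in> vertices G" using assms by (simp add: dominates_def)
  fix X :: "'a set" assume X: "finite X" "v \<notin> X"
  obtain F where F: "infinite F" "is_fan G v (range R - {v}) F"
    using assms unfolding dominates_def by blast
  then obtain p where p: "p \<in> F" "set p \<inter> X = {}"
    using disjoint_member[OF F(1) X, of set] unfolding is_fan_def by blast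
  then have "conn (edges G) (- X) v (last p)"
    using F(2) path_conn_hd[of G p "- X" "last p"] unfolding is_fan_def path_in_def by auto
  then show "\<exists>b\<in>range R - {v}. conn (edges G) (- X) v b"
    using F(2) p(1) unfolding is_fan_def by blast
qed

lemma path_edge_in: "Suc i < length p \<Longrightarrow> {p ! i, p ! Suc i} \<in> path_edges p"
  by (auto simp: path_edges_def)

lemma path_edge_vertices: "e \<in> path_edges p \<Longrightarrow> e \<subseteq> set p"
  by (auto simp: path_edges_def)

text \<open>The union of an infinite fan is the star: \<open>v\<close> is its centre and the ends of
  the paths are its leaves.\<close>

lemma linked_imp_star:
  assumes G: "simple_graph G" and L: "linked G v U"
  shows "has_star_attached_to G U"
proof -
  obtain p where p: "\<And>n. path_in G (p n)" "\<And>n::nat. hd (p n) = v"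
    "\<And>n. set (p n) \<inter> (U - {v}) = {last (p n)}"
    "\<And>m n. m \<noteq> n \<Longrightarrow> set (p m) \<inter> set (p n) = {v}"
    using linked_fan[OF assms] by blast
  have ne: "p n \<noteq> []" and di: "distinct (p n)" for n using p(1)[of n] by (auto simp: path_in_def)
  have lU: "last (p n) \<in> U" and lv: "last (p n) \<noteq> v" for n using p(3)[of n] by auto
  have len: "2 \<le> length (p n)" for n
  proof (rule ccontr)
    assume "\<not> 2 \<le> length (p n)"
    moreover have "0 < length (p n)" using ne[of n] by simp
    ultimately have "length (p n) = 1" by linarith
    then obtain a where "p n = [a]" by (auto simp: length_Suc_conv)
    then show False using p(2)[of n] lv[of n] by simp
  qed
  have lin: "last (p m) \<notin> set (p n)" if "m \<noteq> n" for m n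
    using p(4)[OF that] lv[of m] last_in_set[OF ne[of m]] by auto
  have inj: "last (p m) = last (p n) \<Longrightarrow> m = n" for m n
    using lin[of m n] last_in_set[OF ne[of n]] by auto
  define L where "L = range (\<lambda>n. last (p n))"
  define H where "H = Graph (insert v L) {{v, w} | w. w \<in> L}"
  define S where "S = Graph (\<Union>n. set (p n)) (\<Union>n. path_edges (p n))"
  \<comment> \<open>\<open>SOME\<close> recovers the index of the fan path from an edge of
    \<open>H\<close>; it is unique since distinct paths have distinct ends.\<close>
  define P where "P e = p (SOME n. e = {v, last (p n)})" for e
  have Pp: "P {v, last (p n)} = p n" for n
  proof -
    have "(SOME m. {v, last (p n)} = {v, last (p m)}) = n"
    proof (rule some_equality)
      fix m assume "{v, last (p n)} = {v, last (p m)}"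
      then show "m = n" using lv[of n] lv[of m] inj[of m n] by (auto simp: doubleton_eq_iff)
    qed simp
    then show ?thesis by (simp add: P_def)
  qed
  have vL: "v \<notin> L" using lv by (auto simp: L_def)
  have infL: "infinite L"
    unfolding L_def using finite_imageD[of "\<lambda>n. last (p n)" UNIV] inj by (auto simp: inj_def)
  have star: "infinite_star H"
    unfolding infinite_star_def
  proof (intro conjI bexI[of _ v])
    have "vertices H - {v} = L" using vL by (auto simp: H_def)
    then show "edges H = {{v, w} | w. w \<in> vertices H - {v}}" by (simp add: H_def)
  qed (use infL in \<open>auto simp: H_def\<close>)
  have inner: "inner_vertices (p n) = set (p n) - {v, last (p n)}" for n
    using inner_vertices_eq[OF di len] p(2) by simp
  have eH: "edges H = {{v, last (p n)} | n. True}" by (auto simp: H_def L_def)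
  have pS: "path_in S (p n)" for n
    using p(1)[of n] unfolding path_in_def S_def by (auto intro: path_edge_in)
  have sub: "is_subdivision S H"
    unfolding is_subdivision_def
  proof (intro exI[of _ P] conjI ballI impI)
    fix e assume "e \<in> edges H"
    then obtain n where e: "e = {v, last (p n)}" by (auto simp: eH)
    show "path_in S (P e)" "{hd (P e), last (P e)} = e" using pS p(2) by (auto simp: e Pp)
    show "inner_vertices (P e) \<inter> vertices H = {}"
    proof -
      have "last (p m) \<notin> inner_vertices (p n)" for m using lin[of m n] by (cases "m = n") (auto simp: inner)
      then show ?thesis by (auto simp: e Pp inner H_def L_def)
    qed
    fix f assume "f \<in> edges H" "e \<noteq> f"
    then obtain m where f: "f = {v, last (p m)}" "m \<noteq> n" using e by (auto simp: eH)
    show "inner_vertices (P e) \<inter> inner_vertices (P f) = {}"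
      using p(4)[OF f(2)] by (auto simp: e f(1) Pp inner)
  next
    have *: "(\<Union>e\<in>edges H. g (P e)) = (\<Union>n. g (p n))" for g :: "'a list \<Rightarrow> 'b set"
    proof -
      have "edges H = range (\<lambda>n. {v, last (p n)})" by (auto simp: eH)
      then show ?thesis by (simp add: Pp)
    qed
    show "vertices S = vertices H \<union> (\<Union>e\<in>edges H. set (P e))"
    proof -
      have "v \<in> set (p 0)" using p(2)[of 0] ne[of 0] hd_in_set by metis
      then have "vertices H \<subseteq> (\<Union>n. set (p n))" using ne last_in_set by (fastforce simp: H_def L_def)
      then show ?thesis unfolding * by (auto simp: S_def)
    qed
    show "edges S = (\<Union>e\<in>edges H. path_edges (P e))" unfolding * by (simp add: S_def)
  qed
  have SG: "vertices S \<subseteq> vertices G" "edges S \<subseteq> edges G"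
    using p(1) by (auto simp: S_def path_in_def path_edges_def)
  have "simple_graph S"
    unfolding simple_graph_def
  proof
    fix e assume e: "e \<in> edges S"
    then have "e \<in> edges G" using SG by auto
    then obtain a b where ab: "e = {a, b}" "a \<noteq> b" using G unfolding simple_graph_def by blast
    have "e \<subseteq> vertices S"
      using e path_edge_vertices[of e] unfolding S_def ugraph.sel by blast
    then show "\<exists>u\<in>vertices S. \<exists>v\<in>vertices S. u \<noteq> v \<and> e = {u, v}" using ab by auto
  qed
  then have SG': "is_subgraph S G" using SG by (simp add: is_subgraph_def)
  have "leaves S \<subseteq> U"
  proof
    fix x assume "x \<in> leaves S"
    then obtain n where x: "x \<in> set (p n)" and c: "card (nbhd S x) = 1"
      by (auto simp: leaves_def S_def)
    then obtain y where y: "nbhd S x = {y}" by (auto simp: card_1_singleton_iff)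
    obtain i where i: "i < length (p n)" "x = p n ! i" using x by (auto simp: in_set_conv_nth)
    have nb: "p m ! Suc j \<in> nbhd S (p m ! j) \<and> p m ! j \<in> nbhd S (p m ! Suc j)"
      if "Suc j < length (p m)" for m j
      using path_edge_in[OF that] by (auto simp: nbhd_def S_def insert_commute)
    \<comment> \<open>The centre is no leaf: its only neighbour \<open>y\<close> would be the second
      vertex of every path, so two paths would share a vertex besides \<open>v\<close>.\<close>
    have "i \<noteq> 0"
    proof
      assume "i = 0"
      then have xv: "x = p m ! 0" for m using i(2) p(2) ne by (metis hd_conv_nth)
      have "p m ! Suc 0 = y" for m using nb[of 0 m] len[of m] y xv[of m] by auto
      then have "y \<in> set (p 0) \<inter> set (p 1)" using len 
        by (metis IntI One_nat_def Suc_1 Suc_le_lessD nth_mem)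
      then have "y = p 0 ! 0" using p(4)[of 0 1] p(2)[of 0] ne[of 0] by (auto simp: hd_conv_nth)
      then have "p 0 ! Suc 0 = p 0 ! 0" using \<open>\<And>m. p m ! Suc 0 = y\<close> by simp
      then show False using di[of 0] len[of 0] ne[of 0] nth_eq_iff_index_eq[of "p 0" "Suc 0" 0] by simp
    qed
    then obtain j where j: "i = Suc j" by (cases i) auto
    have "i = length (p n) - 1"
    proof (rule ccontr)
      assume "\<not> ?thesis"
      then have "Suc i < length (p n)" using i by auto
      then have "p n ! Suc i = y" "p n ! j = y" using nb[of i n] nb[of j n] i y j by auto
      then show False
        using di[of n] \<open>Suc i < length (p n)\<close> j nth_eq_iff_index_eq[of "p n" "Suc i" j] by auto
    qed
    then show "x \<in> U" using i(2) ne[of n] lU[of n] by (simp add: last_conv_nth)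
  qed
  then show ?thesis unfolding has_star_attached_to_def using star sub SG' by blast
qed

text \<open>Only finitely many of the paths from the centre \<open>c\<close> meet a finite
  \<open>X\<close>, and each branch vertex other than \<open>c\<close> is a leaf of
  \<open>S\<close>, hence in \<open>U\<close>.\<close>

lemma star_imp_linked:
  assumes "has_star_attached_to G U"
  shows "\<exists>v. linked G v U"
proof -
  obtain H S where H: "infinite_star H" and S: "is_subdivision S H" "is_subgraph S G" "leaves S \<subseteq> U"
    using assms unfolding has_star_attached_to_def by blast
  obtain c where c: "c \<in> vertices H" "edges H = {{c, v} | v. v \<in> vertices H - {c}}"
    and inf: "infinite (vertices H)" using H unfolding infinite_star_def by blast
  obtain P where P: "\<And>e. e \<in> edges H \<Longrightarrow> path_in S (P e) \<and> {hd (P e), last (P e)} = e \<and>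
        inner_vertices (P e) \<inter> vertices H = {}"
     "\<And>e f. e \<in> edges H \<Longrightarrow> f \<in> edges H \<Longrightarrow> e \<noteq> f \<Longrightarrow>
        inner_vertices (P e) \<inter> inner_vertices (P f) = {}"
     "vertices S = vertices H \<union> (\<Union>e\<in>edges H. set (P e))"
     "edges S = (\<Union>e\<in>edges H. path_edges (P e))"
    using S(1) unfolding is_subdivision_def by metis
  define A where "A = vertices H - {c}"
  define Q where "Q w = P {c, w}" for w
  have eA: "{c, w} \<in> edges H" if "w \<in> A" for w
    using that unfolding c(2) A_def by blast
  have Q: "path_in S (Q w)" "{hd (Q w), last (Q w)} = {c, w}" "inner_vertices (Q w) \<inter> vertices H = {}"
    if "w \<in> A" for w using P(1)[OF eA[OF that]] by (auto simp: Q_def)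
  have Qlen: "2 \<le> length (Q w)" if "w \<in> A" for w
  proof (rule ccontr)
    assume "\<not> 2 \<le> length (Q w)"
    moreover have "0 < length (Q w)" using Q(1)[OF that] by (simp add: path_in_def)
    ultimately have "length (Q w) = 1" by linarith
    then obtain a where "Q w = [a]" by (auto simp: length_Suc_conv)
    then show False using Q(2)[OF that] that by (auto simp: A_def)
  qed
  have inner: "inner_vertices (Q w) = set (Q w) - {c, w}" if "w \<in> A" for w
    using inner_vertices_eq[of "Q w"] Qlen[OF that] Q(1,2)[OF that] by (simp add: path_in_def)
  have cw: "c \<in> set (Q w)" "w \<in> set (Q w)" if "w \<in> A" for w
  proof -
    have "{hd (Q w), last (Q w)} \<subseteq> set (Q w)" using Q(1)[OF that] by (simp add: path_in_def)
    then show "c \<in> set (Q w)" "w \<in> set (Q w)" using Q(2)[OF that] by auto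
  qed
  have notin: "w \<notin> set (Q u)" if "w \<in> A" "u \<in> A" "u \<noteq> w" for u w
  proof
    assume "w \<in> set (Q u)"
    then have "w \<in> inner_vertices (Q u)" using inner[OF that(2)] that by (simp add: A_def)
    then show False using Q(3)[OF that(2)] that(1) by (auto simp: A_def)
  qed
  have disj: "set (Q u) \<inter> set (Q w) \<subseteq> {c}" if "u \<in> A" "w \<in> A" "u \<noteq> w" for u w
  proof -
    have "{c, u} \<noteq> {c, w}" using that(3) by (auto simp: doubleton_eq_iff)
    then have "inner_vertices (Q u) \<inter> inner_vertices (Q w) = {}"
      using P(2)[OF eA[OF that(1)] eA[OF that(2)]] unfolding Q_def by blast
    then show ?thesis
      using inner[OF that(1)] inner[OF that(2)] that notin[of u w] notin[of w u] by blast
  qed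
  have eS: "edges S = (\<Union>w\<in>A. path_edges (Q w))" using P(4) c(2) by (auto simp: A_def Q_def)
  have leaf: "w \<in> U" if w: "w \<in> A" for w
  proof -
    let ?q = "Q w"
    have di: "distinct ?q" "?q \<noteq> []" using Q(1)[OF w] by (auto simp: path_in_def)
    \<comment> \<open>\<open>is_subdivision\<close> leaves the direction of \<open>P e\<close> open,
      so \<open>w\<close> can be the first or the last vertex of \<open>Q w\<close>;
      \<open>n\<close> is its neighbour on that path in either case.\<close>
    define n where "n = (if w = hd ?q then ?q ! 1 else ?q ! (length ?q - 2))"
    have only: "{w, y} \<in> edges S \<longleftrightarrow> {w, y} \<in> path_edges ?q" for y
    proof
      assume "{w, y} \<in> edges S"
      then obtain u where "u \<in> A" "{w, y} \<in> path_edges (Q u)" by (auto simp: eS)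
      then show "{w, y} \<in> path_edges ?q"
        using notin[of w u] w path_edge_vertices[of "{w, y}" "Q u"] by (cases "u = w") auto
    qed (use w in \<open>auto simp: eS\<close>)
    have "nbhd S w = {n}"
    proof (cases "w = hd ?q")
      case True
      then have w0: "w = ?q ! 0" using di by (simp add: hd_conv_nth)
      have "{w, y} \<in> path_edges ?q \<longleftrightarrow> y = ?q ! 1" for y
      proof
        assume "{w, y} \<in> path_edges ?q"
        then obtain i where i: "Suc i < length ?q" "{w, y} = {?q ! i, ?q ! Suc i}"
          by (auto simp: path_edges_def)
        have "w \<noteq> ?q ! Suc i"
          using di i w0 nth_eq_iff_index_eq[of ?q 0 "Suc i"] Qlen[OF w] by auto
        then have "w = ?q ! i" "y = ?q ! Suc i" using i by (auto simp: doubleton_eq_iff)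
        then show "y = ?q ! 1"
          using di i w0 nth_eq_iff_index_eq[of ?q 0 i] Qlen[OF w] by auto
      next
        assume "y = ?q ! 1"
        then show "{w, y} \<in> path_edges ?q" using w0 path_edge_in[of 0 ?q] Qlen[OF w] by auto
      qed
      then show ?thesis using True by (auto simp: nbhd_def only n_def)
    next
      case False
      define k where "k = length ?q - 2"
      have len: "length ?q = Suc (Suc k)" using Qlen[OF w] by (simp add: k_def)
      have "w = last ?q" using False Q(2)[OF w] by (auto simp: doubleton_eq_iff)
      then have w0: "w = ?q ! Suc k" using di len by (simp add: last_conv_nth)
      have "{w, y} \<in> path_edges ?q \<longleftrightarrow> y = ?q ! k" for y
      proof
        assume "{w, y} \<in> path_edges ?q"
        then obtain i where i: "Suc i < length ?q" "{w, y} = {?q ! i, ?q ! Suc i}"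
          by (auto simp: path_edges_def)
        have "w \<noteq> ?q ! i"
          using di i w0 nth_eq_iff_index_eq[of ?q "Suc k" i] len by auto
        then have "w = ?q ! Suc i" "y = ?q ! i" using i by (auto simp: doubleton_eq_iff)
        then show "y = ?q ! k"
          using di i w0 nth_eq_iff_index_eq[of ?q "Suc k" "Suc i"] len by auto
      next
        assume "y = ?q ! k"
        then show "{w, y} \<in> path_edges ?q"
          using w0 path_edge_in[of k ?q] len by (auto simp: insert_commute)
      qed
      then show ?thesis using False by (auto simp: nbhd_def only n_def k_def)
    qed
    moreover have "w \<in> vertices S" using w P(3) by (auto simp: A_def)
    ultimately show ?thesis using S(3) by (auto simp: leaves_def)
  qed
  have infA: "infinite A" using inf by (simp add: A_def)
  have "linked G c U"
    unfolding linked_def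
  proof (intro conjI allI impI)
    show "c \<in> vertices G" using c(1) P(3) S(2) by (auto simp: is_subgraph_def)
    fix X :: "'a set" assume X: "finite X" "c \<notin> X"
    then obtain w where w: "w \<in> A" "set (Q w) \<inter> X = {}"
      using disjoint_member[OF infA X, of "\<lambda>w. set (Q w)"] disj by blast
    then have "conn (edges S) (- X) c w"
      using path_conn[OF Q(1)[OF w(1)], of "- X" c w] cw by blast
    then have "conn (edges G) (- X) c w"
      using S(2) conn_mono[of "edges S" "- X" c w "- X" "edges G"] by (auto simp: is_subgraph_def)
    then show "\<exists>b\<in>U - {c}. conn (edges G) (- X) c b" using w leaf by (auto simp: A_def)
  qed
  then show ?thesis ..
qed

section \<open>Tied sets and disjoint families of tied rays\<close>

definition tied :: "'a ugraph \<Rightarrow> 'a set \<Rightarrow> 'a set \<Rightarrow> bool" where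
  "tied G B U \<longleftrightarrow> (\<forall>X. finite X \<longrightarrow>
     (\<exists>X'. finite X' \<and> (\<forall>b\<in>B - X'. \<exists>u\<in>U. conn (edges G) (- X) b u)))"

lemma linkedD:
  "linked G v B \<Longrightarrow> finite X \<Longrightarrow> v \<notin> X \<Longrightarrow> \<exists>b\<in>B - {v}. conn (edges G) (- X) v b"
  unfolding linked_def by simp

lemma tiedD:
  "tied G B U \<Longrightarrow> finite X \<Longrightarrow>
    \<exists>Y. finite Y \<and> (\<forall>b\<in>B - Y. \<exists>u\<in>U. conn (edges G) (- X) b u)"
  unfolding tied_def by simp

text \<open>Deleting the exceptional set \<open>Y\<close> of \<open>B\<close> together with
  \<open>X\<close> forces the walks from \<open>A\<close> to arrive in \<open>B - Y\<close>, from
  where they continue to \<open>C\<close>.\<close>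

lemma tied_trans:
  assumes "tied G A B" "tied G B C"
  shows "tied G A C"
  unfolding tied_def
proof (intro allI impI)
  fix X :: "'a set" assume "finite X"
  then obtain Y where Y: "finite Y" "\<And>b. b \<in> B - Y \<Longrightarrow> \<exists>c\<in>C. conn (edges G) (- X) b c"
    using tiedD[OF assms(2)] by meson
  then have "finite (X \<union> Y)" using \<open>finite X\<close> by simp
  then obtain Z where Z: "finite Z" "\<And>a. a \<in> A - Z \<Longrightarrow> \<exists>b\<in>B. conn (edges G) (- (X \<union> Y)) a b"
    using tiedD[OF assms(1)] by meson
  have "\<exists>c\<in>C. conn (edges G) (- X) a c" if a: "a \<in> A - Z" for a
  proof -
    obtain b where b: "b \<in> B" "conn (edges G) (- (X \<union> Y)) a b" using Z(2)[OF a] by blast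
    then have "b \<in> B - Y" using conn_right[OF b(2)] by blast
    then obtain c where "c \<in> C" "conn (edges G) (- X) b c" using Y(2) by blast
    moreover have "conn (edges G) (- X) a b" using conn_mono[OF b(2), of "- X" "edges G"] by blast
    ultimately show ?thesis using conn_trans by metis
  qed
  then show "\<exists>X'. finite X' \<and> (\<forall>b\<in>A - X'. \<exists>u\<in>C. conn (edges G) (- X) b u)" using Z(1) by blast
qed

lemma tied_linked:
  assumes "tied G B U" "linked G v B"
  shows "linked G v U"
  unfolding linked_def
proof (intro conjI allI impI)
  show "v \<in> vertices G" using assms(2) by (simp add: linked_def)
  fix X :: "'a set" assume X: "finite X" "v \<notin> X"
  \<comment> \<open>Deleting \<open>v\<close> as well ensures that the vertex of \<open>U\<close>
    reached in the end differs from \<open>v\<close>.\<close>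
  then have "finite (insert v X)" by simp
  then obtain Y where Y: "finite Y" "\<And>b. b \<in> B - Y \<Longrightarrow> \<exists>u\<in>U. conn (edges G) (- insert v X) b u"
    using tiedD[OF assms(1)] by meson
  \<comment> \<open>A separator must avoid \<open>v\<close>, so \<open>v\<close> is taken out;
    \<open>b \<noteq> v\<close> still gives \<open>b \<notin> Y\<close>.\<close>
  have "finite (X \<union> Y - {v})" "v \<notin> X \<union> Y - {v}" using X Y by auto
  then obtain b where b: "b \<in> B - {v}" "conn (edges G) (- (X \<union> Y - {v})) v b"
    using linkedD[OF assms(2)] by metis
  have "b \<in> B - Y" using conn_right[OF b(2)] b(1) by blast
  then obtain u where u: "u \<in> U" "conn (edges G) (- insert v X) b u" using Y(2) by blast
  have "conn (edges G) (- X) v b" using conn_mono[OF b(2), of "- X" "edges G"] X(2) by blast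
  moreover have "conn (edges G) (- X) b u" using conn_mono[OF u(2), of "- X" "edges G"] by blast
  ultimately have "conn (edges G) (- X) v u" by (rule conn_trans)
  then show "\<exists>b\<in>U - {v}. conn (edges G) (- X) v b" using u(1) conn_right[OF u(2)] by blast
qed

lemma ray_conn:
  assumes "ray_in G R" "\<And>k. m \<le> k \<Longrightarrow> R k \<in> A" "m \<le> i" "m \<le> j"
  shows "conn (edges G) A (R i) (R j)"
proof -
  have "conn (edges G) A (R m) (R k)" if "m \<le> k" for k
    using that
  proof (induction k rule: dec_induct)
    case base
    then show ?case using assms(2) by (simp add: conn_refl)
  next
    case (step n)
    then show ?case using assms(1,2)
      by (intro conn_trans[OF step.IH conn_edge]) (auto simp: ray_in_def)
  qed
  from conn_trans[OF conn_sym[OF this[OF assms(3)]] this[OF assms(4)]] show ?thesis .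
qed

text \<open>By disjointness only finitely many rays meet \<open>X\<close>, and these contribute
  their exceptional sets. A ray missing \<open>X\<close> is connected in \<open>G - X\<close>, so
  one vertex joined to \<open>U\<close> suffices for all of it.\<close>

lemma tied_disjoint_rays:
  assumes R: "\<And>R. R \<in> RR \<Longrightarrow> ray_in G R \<and> tied G (range R) U"
    and disj: "\<And>R S. R \<in> RR \<Longrightarrow> S \<in> RR \<Longrightarrow> R \<noteq> S \<Longrightarrow> range R \<inter> range S = {}"
  shows "tied G (U \<union> (\<Union>R\<in>RR. range R)) U"
  unfolding tied_def
proof (intro allI impI)
  fix X :: "'a set" assume X: "finite X"
  have "\<exists>Y. finite Y \<and> (\<forall>b\<in>range R - Y. \<exists>u\<in>U. conn (edges G) (- X) b u)" if "R \<in> RR" for R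
    using R[OF that] tiedD[OF _ X] by simp
  then obtain Y where Y: "\<And>R. R \<in> RR \<Longrightarrow> finite (Y R)"
    "\<And>R b. R \<in> RR \<Longrightarrow> b \<in> range R - Y R \<Longrightarrow> \<exists>u\<in>U. conn (edges G) (- X) b u"
    by metis
  define M where "M = {R \<in> RR. range R \<inter> X \<noteq> {}}"
  have "\<exists>x. x \<in> range R \<inter> X" if "R \<in> M" for R using that by (auto simp: M_def)
  then obtain h where h: "\<And>R. R \<in> M \<Longrightarrow> h R \<in> range R \<inter> X" by metis
  have "inj_on h M"
  proof (rule inj_onI, rule ccontr)
    fix R S assume "R \<in> M" "S \<in> M" "h R = h S" "R \<noteq> S"
    then show False using h[of R] h[of S] disj[of R S] by (auto simp: M_def)
  qed
  moreover have "finite (h ` M)" using h X by (intro finite_subset[of "h ` M" X]) auto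
  ultimately have M: "finite M" by (rule finite_imageD[rotated])
  define Z where "Z = X \<union> (\<Union>R\<in>M. Y R)"
  have "finite Z" using X M Y(1) by (auto simp: Z_def M_def)
  moreover have "\<exists>u\<in>U. conn (edges G) (- X) b u" if b: "b \<in> U \<union> (\<Union>R\<in>RR. range R) - Z" for b
  proof (cases "b \<in> U")
    case True
    then show ?thesis using b conn_refl[of b "- X"] by (auto simp: Z_def)
  next
    case False
    then obtain R where RR: "R \<in> RR" "b \<in> range R" using b by blast
    show ?thesis
    proof (cases "R \<in> M")
      case True
      then show ?thesis using Y(2)[OF RR(1), of b] RR(2) b by (auto simp: Z_def)
    next
      case False
      have ray: "ray_in G R" using R RR(1) by blast
      have av: "R k \<in> - X" for k using False RR(1) by (auto simp: M_def)
      have "infinite (range R)" using ray finite_imageD[of R UNIV] by (auto simp: ray_in_def)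
      then have "\<not> range R \<subseteq> Y R" using Y(1)[OF RR(1)] finite_subset by blast
      then obtain k where "R k \<in> range R - Y R" by blast
      then obtain u where u: "u \<in> U" "conn (edges G) (- X) (R k) u" using Y(2)[OF RR(1)] by blast
      obtain i where "b = R i" using RR(2) by blast
      then have "conn (edges G) (- X) b (R k)" using ray_conn[OF ray, of 0 "- X" i k] av by simp
      then show ?thesis using u conn_trans by metis
    qed
  qed
  ultimately show "\<exists>X'. finite X' \<and>
      (\<forall>b\<in>U \<union> (\<Union>R\<in>RR. range R) - X'. \<exists>u\<in>U. conn (edges G) (- X) b u)" by blast
qed

section \<open>Trees given by parent functions\<close>

text \<open>Rooted trees encoded by the parent function \<open>f\<close>; the level \<open>l\<close>
  makes iterated parents end in \<open>r\<close> and rules out cycles. The tree-order becomes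
  \<open>par\<^sup>*\<close>.\<close>

locale ptree =
  fixes G :: "'a ugraph" and V :: "'a set" and r :: 'a and f :: "'a \<Rightarrow> 'a" and l :: "'a \<Rightarrow> nat"
  assumes V_sub: "V \<subseteq> vertices G"
    and root: "r \<in> V" "l r = 0"
    and parent: "v \<in> V \<Longrightarrow> v \<noteq> r \<Longrightarrow> f v \<in> V \<and> l v = Suc (l (f v)) \<and> {f v, v} \<in> edges G"
begin

definition par :: "('a \<times> 'a) set" where
  "par = {(f v, v) | v. v \<in> V \<and> v \<noteq> r}"

lemma par_iff: "(x, y) \<in> par \<longleftrightarrow> x = f y \<and> y \<in> V \<and> y \<noteq> r"
  by (auto simp: par_def)

lemma par_props:
  assumes "(x, y) \<in> par"
  shows "x \<in> V" "y \<in> V" "l y = Suc (l x)" "{x, y} \<in> edges G"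
  using assms parent[of y] by (auto simp: par_iff)

lemma le_level:
  assumes "(x, y) \<in> par\<^sup>*"
  shows "l x \<le> l y"
  using assms by (induction rule: rtrancl_induct) (auto dest: par_props(3))

text \<open>The tree path from \<open>x\<close> up to \<open>y\<close> runs through vertices above
  \<open>x\<close> only. Typically \<open>A\<close> is the complement of a finite set with no vertex
  above \<open>x\<close>.\<close>

lemma le_conn:
  assumes "(x, y) \<in> par\<^sup>*" "\<And>z. (x, z) \<in> par\<^sup>* \<Longrightarrow> z \<in> A"
  shows "conn (edges G) A x y"
  using assms(1)
proof (induction rule: rtrancl_induct)
  case base
  then show ?case using assms(2) by (auto intro: conn_refl)
next
  case (step y z)
  have "y \<in> A" "z \<in> A" using step.hyps assms(2) by (auto intro: rtrancl.rtrancl_into_rtrancl)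
  then show ?case using step par_props(4)[OF step.hyps(2)]
    by (auto intro: conn_trans conn_edge)
qed

definition down :: "'a \<Rightarrow> 'a set" where
  "down y = {x. (x, y) \<in> par\<^sup>*}"

lemma down_root: "down r = {r}"
proof -
  have "(x, r) \<in> par\<^sup>* \<Longrightarrow> x = r" for x by (erule rtranclE) (simp_all add: par_iff)
  then show ?thesis by (auto simp: down_def)
qed

lemma down_step:
  assumes "v \<in> V" "v \<noteq> r"
  shows "down v = insert v (down (f v))"
proof -
  have "(x, v) \<in> par\<^sup>* \<Longrightarrow> x = v \<or> (x, f v) \<in> par\<^sup>*" for x
    by (erule rtranclE) (simp_all add: par_iff)
  moreover have "(x, f v) \<in> par\<^sup>* \<Longrightarrow> (x, v) \<in> par\<^sup>*" for x
    using assms by (rule_tac rtrancl.rtrancl_into_rtrancl) (simp_all add: par_iff)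
  ultimately show ?thesis by (auto simp: down_def)
qed

lemma level_induct [consumes 1, case_names base step]:
  assumes "v \<in> V" "P r" "\<And>v. v \<in> V \<Longrightarrow> v \<noteq> r \<Longrightarrow> P (f v) \<Longrightarrow> P v"
  shows "P v"
  using assms(1)
proof (induction "l v" arbitrary: v rule: less_induct)
  case less
  show ?case
  proof (cases "v = r")
    case False
    then show ?thesis using less parent[of v] assms(3)[of v] by auto
  qed (simp add: assms(2))
qed

lemma root_le: "v \<in> V \<Longrightarrow> (r, v) \<in> par\<^sup>*"
  by (induction rule: level_induct) (auto simp: par_iff intro: rtrancl.rtrancl_into_rtrancl)

text \<open>Outside \<open>V\<close> the set \<open>down v\<close> is \<open>{v}\<close>, so unions
  of down-closures over arbitrary finite vertex sets stay finite.\<close>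

lemma finite_down: "finite (down v)"
proof (cases "v \<in> V")
  case True
  then show ?thesis by (induction rule: level_induct) (auto simp: down_root down_step)
next
  case False
  then have "(x, v) \<in> par\<^sup>* \<Longrightarrow> x = v" for x by (erule_tac rtranclE) (simp_all add: par_iff)
  then have "down v = {v}" by (auto simp: down_def)
  then show ?thesis by simp
qed

text \<open>The exceptional set is the union of the down-closures of the vertices of
  \<open>X\<close>: above any other vertex the tree avoids \<open>X\<close>.\<close>

lemma tied_above:
  assumes "\<And>b. b \<in> B \<Longrightarrow> \<exists>u\<in>U. (b, u) \<in> par\<^sup>*"
  shows "tied G B U"
  unfolding tied_def
proof (intro allI impI)
  fix X :: "'a set" assume "finite X"
  then have "finite (\<Union>x\<in>X. down x)" using finite_down by blast
  moreover have "\<exists>u\<in>U. conn (edges G) (- X) b u" if b: "b \<in> B - (\<Union>x\<in>X. down x)" for b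
  proof -
    obtain u where "u \<in> U" "(b, u) \<in> par\<^sup>*" using assms b by blast
    moreover have "z \<in> - X" if "(b, z) \<in> par\<^sup>*" for z using b that by (auto simp: down_def)
    ultimately show ?thesis using le_conn[of b u "- X"] by blast
  qed
  ultimately show "\<exists>X'. finite X' \<and> (\<forall>b\<in>B - X'. \<exists>u\<in>U. conn (edges G) (- X) b u)" by blast
qed

section \<open>Koenig's lemma for the part of the tree below \<open>U\<close>\<close>

definition live :: "'a set \<Rightarrow> 'a \<Rightarrow> 'a set" where
  "live U v = {c. (v, c) \<in> par \<and> (\<exists>u\<in>U. (c, u) \<in> par\<^sup>*)}"

text \<open>Only finitely many children lie below a vertex of \<open>X\<close>; any other live child
  is joined to \<open>U\<close> upwards in the tree, outside \<open>X\<close>.\<close>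

lemma linked_if_infinite_live:
  assumes "infinite (live U v)" "v \<in> V"
  shows "linked G v U"
  unfolding linked_def
proof (intro conjI allI impI)
  show "v \<in> vertices G" using assms(2) V_sub by blast
  fix X :: "'a set" assume X: "finite X" "v \<notin> X"
  then have "finite (\<Union>x\<in>X. down x)" using finite_down by blast
  then have "\<not> live U v \<subseteq> (\<Union>x\<in>X. down x)" using assms(1) finite_subset by blast
  then obtain c where c: "c \<in> live U v" "c \<notin> (\<Union>x\<in>X. down x)" by blast
  then obtain u where u: "(v, c) \<in> par" "u \<in> U" "(c, u) \<in> par\<^sup>*" by (auto simp: live_def)
  have "z \<in> - X" if "(c, z) \<in> par\<^sup>*" for z using c(2) that by (auto simp: down_def)
  then have "conn (edges G) (- X) c u" "c \<in> - X" using le_conn[OF u(3), of "- X"] by blast+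
  then have "conn (edges G) (- X) v u"
    using X(2) par_props(4)[OF u(1)] by (auto intro: conn_trans conn_edge)
  moreover have "u \<noteq> v" using le_level[OF u(3)] par_props(3)[OF u(1)] by auto
  ultimately show "\<exists>b\<in>U - {v}. conn (edges G) (- X) v b" using u(2) by blast
qed

lemma above_split:
  "{u\<in>U. (v, u) \<in> par\<^sup>*} \<subseteq> insert v (\<Union>c\<in>live U v. {u\<in>U. (c, u) \<in> par\<^sup>*})"
proof
  fix u assume "u \<in> {u\<in>U. (v, u) \<in> par\<^sup>*}"
  then have "u \<in> U" "(v, u) \<in> par\<^sup>*" by simp_all
  then show "u \<in> insert v (\<Union>c\<in>live U v. {u\<in>U. (c, u) \<in> par\<^sup>*})"
    by (cases rule: converse_rtranclE[consumes 1, OF \<open>(v, u) \<in> par\<^sup>*\<close>]) (auto simp: live_def)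
qed

text \<open>A vertex with infinitely many elements of \<open>U\<close> above it has a child with the
  same property, since only finitely many children are live. Levels increase along the resulting
  sequence, so it is a ray.\<close>

lemma koenig:
  assumes "U \<subseteq> V" "infinite U" "\<And>v. v \<in> V \<Longrightarrow> finite (live U v)"
  obtains R where "\<forall>n. (R n, R (Suc n)) \<in> par" "\<forall>n. infinite {u\<in>U. (R n, u) \<in> par\<^sup>*}"
    "ray_in G R" "range R \<subseteq> V"
proof -
  define P where "P v \<longleftrightarrow> v \<in> V \<and> infinite {u\<in>U. (v, u) \<in> par\<^sup>*}" for v
  have r: "P r"
  proof -
    have "U \<subseteq> {u\<in>U. (r, u) \<in> par\<^sup>*}" using root_le assms(1) by blast
    then show ?thesis using assms(2) root finite_subset by (auto simp: P_def)
  qed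
  have step: "\<exists>c. P c \<and> (v, c) \<in> par" if "P v" for v
  proof (rule ccontr)
    assume no: "\<not> ?thesis"
    have "finite {u\<in>U. (c, u) \<in> par\<^sup>*}" if "c \<in> live U v" for c
      using no that par_props(2)[of v c] by (auto simp: live_def P_def)
    then have "finite (insert v (\<Union>c\<in>live U v. {u\<in>U. (c, u) \<in> par\<^sup>*}))"
      using assms(3) \<open>P v\<close> by (auto simp: P_def)
    then show False using \<open>P v\<close> finite_subset[OF above_split] by (auto simp: P_def)
  qed
  obtain R where R: "\<And>n. P (R n)" "\<And>n. (R n, R (Suc n)) \<in> par"
    using dependent_nat_choice[of "\<lambda>_. P" "\<lambda>_ x y. (x, y) \<in> par"] r step by blast
  have "l (R n) = l (R 0) + n" for n
    by (induction n) (auto simp: par_props(3)[OF R(2)])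
  then have "inj R" by (metis add_left_cancel injI)
  then have "ray_in G R"
    using R V_sub par_props(4)[OF R(2)] by (auto simp: ray_in_def P_def)
  then show ?thesis using R that[of R] by (auto simp: P_def)
qed

text \<open>By induction, each level contains only finitely many vertices that lie below an element
  of \<open>U\<close>.\<close>

lemma countable_if_finite_live:
  assumes "U \<subseteq> V" "\<And>v. v \<in> V \<Longrightarrow> finite (live U v)"
  shows "countable U"
proof -
  define L where "L n = {v \<in> V. l v = n \<and> (\<exists>u\<in>U. (v, u) \<in> par\<^sup>*)}" for n
  have fin: "finite (L n)" for n
  proof (induction n)
    case 0
    have "L 0 \<subseteq> {r}" using parent by (fastforce simp: L_def)
    then show ?case using finite_subset by blast
  next
    case (Suc n)
    have "L (Suc n) \<subseteq> (\<Union>v\<in>L n. live U v)"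
    proof
      fix c assume c: "c \<in> L (Suc n)"
      then have "c \<in> V" "c \<noteq> r" using root by (auto simp: L_def)
      then have p: "(f c, c) \<in> par" "f c \<in> V" "l c = Suc (l (f c))" using parent by (auto simp: par_iff)
      then have "f c \<in> L n" "c \<in> live U (f c)"
        using c by (auto simp: L_def live_def intro: converse_rtrancl_into_rtrancl)
      then show "c \<in> (\<Union>v\<in>L n. live U v)" by blast
    qed
    moreover have "finite (\<Union>v\<in>L n. live U v)" using Suc assms(2) by (auto simp: L_def)
    ultimately show ?case using finite_subset by blast
  qed
  have "U \<subseteq> (\<Union>n. L n)" using assms(1) by (auto simp: L_def)
  moreover have "countable (\<Union>n. L n)"
    using countable_finite[OF fin] by (rule countable_UN[OF countableI_type])
  ultimately show ?thesis using countable_subset by blast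
qed

end

text \<open>The level of a vertex is its distance from \<open>r\<close> in \<open>A\<close>, and its
  parent is a neighbour at distance one less.\<close>

lemma bfs_ptree:
  assumes A: "A \<subseteq> vertices G" and r: "r \<in> A" and c: "\<And>v. v \<in> A \<Longrightarrow> conn (edges G) A r v"
  obtains f l where "ptree G A r f l"
proof -
  define l where "l v = (LEAST n. (r, v) \<in> adj (edges G) A ^^ n)" for v
  have l: "(r, v) \<in> adj (edges G) A ^^ l v" if "v \<in> A" for v
  proof -
    have "\<exists>n. (r, v) \<in> adj (edges G) A ^^ n" using c[OF that] by (auto simp: conn_def rtrancl_power)
    then show ?thesis unfolding l_def by (rule LeastI_ex)
  qed
  have ex: "\<exists>y. y \<in> A \<and> l v = Suc (l y) \<and> {y, v} \<in> edges G" if v: "v \<in> A" "v \<noteq> r" for v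
  proof (cases "l v")
    case 0
    then show ?thesis using l[OF v(1)] v(2) by simp
  next
    case (Suc n)
    then obtain y where y: "(r, y) \<in> adj (edges G) A ^^ n" "(y, v) \<in> adj (edges G) A"
      using l[OF v(1)] by auto
    have "y \<in> A" "{y, v} \<in> edges G" using y(2) by (auto simp: adj_def)
    moreover have "l y \<le> n" unfolding l_def by (rule Least_le) (rule y(1))
    moreover have "(r, v) \<in> adj (edges G) A ^^ Suc (l y)" using l[OF \<open>y \<in> A\<close>] y(2) by auto
    then have "l v \<le> Suc (l y)" unfolding l_def[of v] by (rule Least_le)
    ultimately show ?thesis using Suc by (intro exI[of _ y]) auto
  qed
  define f where "f v = (SOME y. y \<in> A \<and> l v = Suc (l y) \<and> {y, v} \<in> edges G)" for v
  have f: "f v \<in> A \<and> l v = Suc (l (f v)) \<and> {f v, v} \<in> edges G" if "v \<in> A" "v \<noteq> r" for v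
    unfolding f_def by (rule someI_ex) (rule ex[OF that])
  have "l r = 0" unfolding l_def by (rule Least_eq_0) simp
  then have "ptree G A r f l" using A r f by unfold_locales auto
  then show ?thesis by (rule that)
qed

text \<open>The centre \<open>c\<close> of the star has a fan to \<open>U\<close>. Koenig's lemma,
  applied to a distance tree spanning \<open>T\<close> and the ends of the fan, yields a ray with
  infinitely many of these ends above each of its vertices; \<open>c\<close> dominates it.\<close>

lemma star_excludes_tree:
  assumes G: "simple_graph G" and T: "is_subgraph T G" "connected_graph T" "locally_finite T"
    and U: "U \<subseteq> vertices T" and rays: "\<And>R. ray_in T R \<Longrightarrow> undominated G R"
    and star: "has_star_attached_to G U"
  shows False
proof -
  obtain c where c: "linked G c U" using star_imp_linked[OF star] by blast
  obtain r where r: "r \<in> vertices T" using T(2) by (auto simp: connected_graph_def)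
  \<comment> \<open>The host graph is \<open>T\<close> itself, so the ray obtained below is a ray of
    \<open>T\<close>.\<close>
  obtain f l where "ptree T (vertices T) r f l"
    using bfs_ptree[OF order_refl r] connected_graph_conn[OF T(2) r] by metis
  then interpret ptree T "vertices T" r f l .
  obtain p where p: "\<And>n. path_in G (p n)" "\<And>n::nat. hd (p n) = c"
    "\<And>n. set (p n) \<inter> (U - {c}) = {last (p n)}"
    "\<And>m n. m \<noteq> n \<Longrightarrow> set (p m) \<inter> set (p n) = {c}"
    using linked_fan[OF G c] by blast
  define q where "q n = last (p n)" for n
  have q: "q n \<in> U" "q n \<noteq> c" "q n \<in> set (p n)" for n using p(3)[of n] by (auto simp: q_def)
  have inj: "inj q"
  proof (rule injI, rule ccontr)
    fix m n assume "q m = q n" "m \<noteq> n"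
    then show False using p(4)[of m n] q(2,3)[of m] q(3)[of n] by auto
  qed
  have fin: "finite (live (range q) v)" if "v \<in> vertices T" for v
  proof -
    have "live (range q) v \<subseteq> nbhd T v" using par_props(4) by (auto simp: live_def nbhd_def)
    then show ?thesis using T(3) that finite_subset unfolding locally_finite_def by blast
  qed
  have "range q \<subseteq> vertices T" "infinite (range q)"
    using q(1) U finite_imageD[OF _ inj] by auto
  then obtain R where R: "\<And>n. infinite {u\<in>range q. (R n, u) \<in> par\<^sup>*}" "ray_in T R"
    using koenig[OF _ _ fin] by metis
  have "linked G c (range R)"
    unfolding linked_def
  proof (intro conjI allI impI)
    show "c \<in> vertices G" using c by (simp add: linked_def)
    fix X :: "'a set" assume X: "finite X" "c \<notin> X"
    then have "finite (\<Union>x\<in>insert c X. down x)" using finite_down by blast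
    moreover have "infinite (range R)" using R(2) finite_imageD[of R UNIV] by (auto simp: ray_in_def)
    ultimately have "\<not> range R \<subseteq> (\<Union>x\<in>insert c X. down x)" using finite_subset by blast
    \<comment> \<open>Nothing above this \<open>R n\<close> lies in \<open>X\<close>, and
      \<open>R n\<close> is not \<open>c\<close>. So a fan path that avoids \<open>X\<close> and
      ends above \<open>R n\<close> joins \<open>c\<close> to \<open>R n\<close> outside
      \<open>X\<close>.\<close>
    then obtain n where n: "R n \<notin> (\<Union>x\<in>insert c X. down x)" by blast
    define K where "K = {k. (R n, q k) \<in> par\<^sup>*}"
    have "{u\<in>range q. (R n, u) \<in> par\<^sup>*} = q ` K" by (auto simp: K_def)
    then have "infinite K" using R(1)[of n] by auto
    then obtain k where k: "k \<in> K" "set (p k) \<inter> X = {}"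
      using disjoint_member[OF _ X, of K "\<lambda>k. set (p k)"] p(4) by blast
    have "conn (edges G) (- X) c (q k)"
      using path_conn_hd[OF p(1)[of k], of "- X" "q k"] k(2) q(3) p(2) by auto
    moreover have "z \<in> - X" if "(R n, z) \<in> par\<^sup>*" for z using n that by (auto simp: down_def)
    then have "conn (edges T) (- X) (R n) (q k)" using le_conn k(1) unfolding K_def by blast
    then have "conn (edges G) (- X) (q k) (R n)"
      using T(1) conn_mono conn_sym unfolding is_subgraph_def by (metis order_refl)
    moreover have "R n \<noteq> c" using n by (auto simp: down_def)
    ultimately show "\<exists>b\<in>range R - {c}. conn (edges G) (- X) c b" using conn_trans by fast
  qed
  then show False using linked_imp_dominates[OF G] rays[OF R(2)] unfolding undominated_def by blast
qed

section \<open>The tree of a parent function as a subgraph\<close>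

context ptree
begin

definition tree :: "'a ugraph" where
  "tree = Graph V {{f v, v} | v. v \<in> V \<and> v \<noteq> r}"

lemma vertices_tree [simp]: "vertices tree = V"
  by (simp add: tree_def)

lemma tree_edge: "v \<in> V \<Longrightarrow> v \<noteq> r \<Longrightarrow> {f v, v} \<in> edges tree"
  by (auto simp: tree_def)

lemma tree_edge_cases:
  assumes "{x, y} \<in> edges tree"
  shows "(x, y) \<in> par \<or> (y, x) \<in> par"
  using assms by (auto simp: tree_def par_iff doubleton_eq_iff)

lemma simple_tree: "simple_graph tree"
  unfolding simple_graph_def
proof
  fix e assume "e \<in> edges tree"
  then obtain v where "v \<in> V" "v \<noteq> r" "e = {f v, v}" by (auto simp: tree_def)
  then show "\<exists>u\<in>vertices tree. \<exists>v\<in>vertices tree. u \<noteq> v \<and> e = {u, v}"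
    using parent[of v] by (intro bexI[of _ "f v"] bexI[of _ v]) auto
qed

lemma tree_subgraph: "is_subgraph tree G"
  using simple_tree V_sub parent by (auto simp: is_subgraph_def tree_def)

lemma path_from_root:
  assumes "y \<in> V"
  shows "\<exists>p. path_in tree p \<and> hd p = r \<and> last p = y \<and> set p = down y"
  using assms
proof (induction rule: level_induct)
  case base
  show ?case
    using root by (intro exI[of _ "[r]"]) (simp add: path_in_iff down_root)
next
  case (step v)
  then obtain p where p: "path_in tree p" "hd p = r" "last p = f v" "set p = down (f v)" by blast
  have "v \<notin> down (f v)"
    using le_level[of v "f v"] parent[OF step(1,2)] by (auto simp: down_def)
  then have "path_in tree (p @ [v])"
    using p tree_edge[OF step(1,2)] step(1) by (auto simp: path_in_iff successively_append_iff)
  moreover have "p \<noteq> []" using p(1) by (simp add: path_in_def)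
  ultimately show ?case
    using p down_step[OF step(1,2)] by (intro exI[of _ "p @ [v]"]) simp
qed

lemma tree_leI: "y \<in> V \<Longrightarrow> x \<in> down y \<Longrightarrow> tree_le tree r x y"
  using path_from_root[of y] unfolding tree_le_def by blast

lemma connected_tree: "connected_graph tree"
  unfolding connected_graph_def
proof (intro conjI ballI)
  show "vertices tree \<noteq> {}" using root by auto
  fix u v assume uv: "u \<in> vertices tree" "v \<in> vertices tree"
  have *: "conn (edges tree) UNIV r y" if "y \<in> V" for y
  proof -
    obtain p where p: "path_in tree p" "hd p = r" "last p = y" using path_from_root[OF \<open>y \<in> V\<close>] by blast
    then have "y \<in> set p" using last_in_set[of p] by (simp add: path_in_def)
    then show ?thesis using path_conn_hd[OF p(1), of UNIV y] p(2) by simp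
  qed
  have "conn (edges tree) UNIV u v" 
    using uv conn_trans[OF conn_sym[OF *[of u]] *[of v]] by simp
  then show "\<exists>p. path_in tree p \<and> hd p = u \<and> last p = v"
    using conn_imp_path[OF simple_tree uv(1)] by blast
qed

text \<open>At a vertex of maximal level of a cycle both cyclic neighbours would be its parent.\<close>

lemma acyclic_tree: "\<not> is_cycle tree c"
proof
  assume c: "is_cycle tree c"
  define n where "n = length c"
  have n: "3 \<le> n" and di: "distinct c" using c by (auto simp: is_cycle_def path_in_def n_def)
  have "0 \<in> {..<n}" using n by simp
  then have "finite ((\<lambda>i. l (c ! i)) ` {..<n})" "(\<lambda>i. l (c ! i)) ` {..<n} \<noteq> {}" by blast+
  then have "Max ((\<lambda>i. l (c ! i)) ` {..<n}) \<in> (\<lambda>i. l (c ! i)) ` {..<n}" by (rule Max_in)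
  then obtain i where i: "i < n" "l (c ! i) = Max ((\<lambda>i. l (c ! i)) ` {..<n})" by force
  have mx: "l (c ! j) \<le> l (c ! i)" if "j < n" for j using that unfolding i(2) by (intro Max_ge) auto
  have edge: "{c ! j, c ! Suc j} \<in> edges tree" if "Suc j < n" for j
    using c that by (auto simp: is_cycle_def path_in_def n_def)
  have ce: "{c ! (n - 1), c ! 0} \<in> edges tree"
    using c n by (auto simp: is_cycle_def n_def hd_conv_nth last_conv_nth path_in_def)
  have up: "c ! j = f (c ! i)" if "{c ! j, c ! i} \<in> edges tree" "j < n" for j
    using tree_edge_cases[OF that(1)] mx[OF that(2)] par_props(3)[of "c ! i" "c ! j"]
    by (auto simp: par_iff)
  \<comment> \<open>\<open>s\<close> and \<open>j\<close> are the cyclic successor and predecessor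
    of \<open>i\<close>; they differ because the cycle has at least three vertices.\<close>
  define s where "s = (if i = n - 1 then 0 else Suc i)"
  define j where "j = (if i = 0 then n - 1 else i - 1)"
  have sj: "s < n" "j < n" "s \<noteq> j" using i n by (auto simp: s_def j_def split: if_splits)
  have "{c ! s, c ! i} \<in> edges tree"
    using ce edge[of i] i n by (auto simp: s_def insert_commute)
  moreover have "{c ! j, c ! i} \<in> edges tree"
    using ce edge[of "i - 1"] i n by (auto simp: j_def)
  ultimately have "c ! s = c ! j" using up[of s] up[of j] sj by simp
  then show False using di sj nth_eq_iff_index_eq[of c s j] by (simp add: n_def)
qed

lemma rooted_tree: "is_rooted_tree tree r"
  using simple_tree connected_tree acyclic_tree root by (simp add: is_rooted_tree_def is_tree_def)

lemma nbhd_tree: "nbhd tree v \<subseteq> insert (f v) {c. (v, c) \<in> par}"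
  using tree_edge_cases[of v] by (auto simp: nbhd_def par_iff)

end

section \<open>Envelopes\<close>

text \<open>In a distance tree spanning \<open>G\<close>, a vertex with infinitely many live
  children would be linked to \<open>W\<close>.\<close>

lemma no_linked_countable:
  assumes G: "connected_graph G" and W: "W \<subseteq> vertices G" and no: "\<And>v. \<not> linked G v W"
  shows "countable W"
proof -
  obtain r where r: "r \<in> vertices G" using G by (auto simp: connected_graph_def)
  obtain f l where "ptree G (vertices G) r f l"
    using bfs_ptree[OF order_refl r] connected_graph_conn[OF G r] by metis
  then interpret ptree G "vertices G" r f l .
  show ?thesis using countable_if_finite_live[OF W] linked_if_infinite_live no by blast
qed

text \<open>A form of the star-comb lemma: infinitely many neighbours of the component of
  \<open>d\<close> in \<open>G - W\<close> yield a star, which \<open>no\<close> excludes, or a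
  comb, whose spine is \<open>R\<close>.\<close>

lemma star_comb:
  assumes G: "simple_graph G" and d: "d \<in> vertices G - W" and W: "W \<subseteq> vertices G"
    and inf: "infinite {y \<in> W. \<exists>c. conn (edges G) (- W) d c \<and> {c, y} \<in> edges G}"
    and no: "\<And>v. \<not> linked G v W"
  obtains R where "ray_in G R" "range R \<inter> W = {}" "tied G (range R) W"
proof -
  define C where "C = {c. conn (edges G) (- W) d c}"
  define N where "N = {y \<in> W. \<exists>c\<in>C. {c, y} \<in> edges G}"
  have NW: "N \<subseteq> W" and infN: "infinite N" using inf by (auto simp: N_def C_def)
  have CW: "C \<inter> W = {}" using conn_right[of "edges G" "- W" d] by (auto simp: C_def)
  have C: "C \<subseteq> vertices G"
  proof
    fix c assume "c \<in> C"
    then have "conn (edges G) (- W) d c" by (simp add: C_def)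
    then show "c \<in> vertices G" by (rule conn_closed) (use d edge_in_vertices[OF G] in auto)
  qed
  have dC: "d \<in> C" using d by (auto simp: C_def intro: conn_refl)
  have "conn (edges G) C d c" if "c \<in> C" for c using that conn_inside by (simp add: C_def)
  then obtain f l where "ptree G C d f l" using bfs_ptree[OF C dC] by metis
  then interpret C: ptree G C d f l .
  have "\<forall>y\<in>N. \<exists>c. c \<in> C \<and> {c, y} \<in> edges G" by (auto simp: N_def)
  then obtain g where g: "\<And>y. y \<in> N \<Longrightarrow> g y \<in> C \<and> {g y, y} \<in> edges G" by metis
  \<comment> \<open>The neighbours \<open>N\<close> are hung as leaves onto a distance tree of the
    component \<open>C\<close>.\<close>
  define f' where "f' y = (if y \<in> N then g y else f y)" for y
  define l' where "l' y = (if y \<in> N then Suc (l (g y)) else l y)" for y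
  have CN: "c \<notin> N" if "c \<in> C" for c using that CW NW by blast
  interpret ptree G "C \<union> N" d f' l'
  proof
    show "C \<union> N \<subseteq> vertices G" using C NW W by blast
    show "d \<in> C \<union> N" "l' d = 0" using dC CN C.root by (auto simp: l'_def)
    fix v assume "v \<in> C \<union> N" "v \<noteq> d"
    then show "f' v \<in> C \<union> N \<and> l' v = Suc (l' (f' v)) \<and> {f' v, v} \<in> edges G"
      using g[of v] C.parent[of v] CN[of "g v"] CN[of "f v"] CN[of v]
      by (cases "v \<in> N") (auto simp: f'_def l'_def)
  qed
  have "\<not> linked G v N" for v using no linked_mono[OF _ NW] by blast
  then have fin: "finite (live N v)" if "v \<in> C \<union> N" for v using linked_if_infinite_live that by blast
  obtain R where R: "\<forall>n. (R n, R (Suc n)) \<in> par"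
    "\<forall>n. infinite {u\<in>N. (R n, u) \<in> par\<^sup>*}" "ray_in G R" "range R \<subseteq> C \<union> N"
    by (rule koenig[OF Un_upper2 infN fin])
  \<comment> \<open>Each vertex of \<open>R\<close> is the parent of the next one, and all parents
    lie in \<open>C\<close>.\<close>
  have RC: "R n \<in> C" for n
    using spec[OF R(1), of n] g[of "R (Suc n)"] C.parent[of "R (Suc n)"]
    by (auto simp: par_iff f'_def)
  have "tied G (range R) W"
  proof (rule tied_above)
    fix b assume "b \<in> range R"
    then have "infinite {u\<in>N. (b, u) \<in> par\<^sup>*}" using R(2) by blast
    then have "{u\<in>N. (b, u) \<in> par\<^sup>*} \<noteq> {}" by force
    then show "\<exists>u\<in>W. (b, u) \<in> par\<^sup>*" using NW by blast
  qed
  then show ?thesis using that R(3) RC CW by blast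
qed

text \<open>Zorn's lemma provides the maximal family of rays. A component of \<open>G - W\<close>
  with infinitely many neighbours would contain a further ray tied to \<open>W\<close>, hence to
  \<open>U\<close>, against maximality.\<close>

lemma envelope:
  assumes G: "simple_graph G" "connected_graph G" and U: "U \<subseteq> vertices G"
    and no: "\<not> has_star_attached_to G U"
  obtains W where "U \<subseteq> W" "W \<subseteq> vertices G" "countable W"
    "\<forall>d\<in>vertices G - W.
       finite {y \<in> W. \<exists>c. conn (edges G) (- W) d c \<and> {c, y} \<in> edges G}"
proof -
  define \<A> where "\<A> = {RR. (\<forall>R\<in>RR. ray_in G R \<and> tied G (range R) U) \<and>
     (\<forall>R\<in>RR. \<forall>S\<in>RR. R \<noteq> S \<longrightarrow> range R \<inter> range S = {})}"
  have "\<Union>\<C> \<in> \<A>" if ch: "subset.chain \<A> \<C>" for \<C>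
  proof -
    have "range R \<inter> range S = {}" if RS: "R \<in> A" "A \<in> \<C>" "S \<in> B" "B \<in> \<C>" "R \<noteq> S" for R S A B
    proof -
      have "A \<subseteq> B \<or> B \<subseteq> A" "A \<in> \<A>" "B \<in> \<A>" using ch RS unfolding subset_chain_def by auto
      then obtain D where "D \<in> \<A>" "R \<in> D" "S \<in> D" using RS(1,3) by blast
      then show ?thesis using RS(5) unfolding \<A>_def by blast
    qed
    then show ?thesis using ch by (auto simp: \<A>_def subset_chain_def)
  qed
  then obtain RR where RR: "RR \<in> \<A>" "\<And>Q. Q \<in> \<A> \<Longrightarrow> RR \<subseteq> Q \<Longrightarrow> Q = RR"
    using subset_Zorn'[of \<A>] by blast
  define W where "W = U \<union> (\<Union>R\<in>RR. range R)"
  have tW: "tied G W U"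
    unfolding W_def by (rule tied_disjoint_rays) (use RR(1) in \<open>simp_all add: \<A>_def\<close>)
  have "range R \<subseteq> vertices G" if "R \<in> RR" for R
    using RR(1) that by (simp add: \<A>_def ray_in_def)
  then have WV: "W \<subseteq> vertices G" using U unfolding W_def by blast
  have nW: "\<not> linked G v W" for v
    using tied_linked[OF tW] linked_imp_star[OF G(1)] no by blast
  show ?thesis
  proof (rule that[of W])
    show "U \<subseteq> W" by (simp add: W_def)
    show "countable W" by (rule no_linked_countable[OF G(2) WV nW])
    show "\<forall>d\<in>vertices G - W.
      finite {y \<in> W. \<exists>c. conn (edges G) (- W) d c \<and> {c, y} \<in> edges G}"
    proof
      fix d assume d: "d \<in> vertices G - W"
      show "finite {y \<in> W. \<exists>c. conn (edges G) (- W) d c \<and> {c, y} \<in> edges G}"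
      proof (rule ccontr)
        assume "infinite {y \<in> W. \<exists>c. conn (edges G) (- W) d c \<and> {c, y} \<in> edges G}"
        then obtain R where R: "ray_in G R" "range R \<inter> W = {}" "tied G (range R) W"
          using star_comb[OF G(1) d WV _ nW] by metis
        have "range R \<inter> range S = {}" if "S \<in> RR" for S using R(2) that by (auto simp: W_def)
        then have "insert R RR \<in> \<A>"
          using RR(1) R(1) tied_trans[OF R(3) tW] unfolding \<A>_def by (simp add: Int_commute)
        then have "R \<in> RR" using RR(2)[of "insert R RR"] by blast
        then show False using R(2) by (auto simp: W_def)
      qed
    qed
  qed (rule WV)
qed

section \<open>Construction of the normal tree\<close>

text \<open>For every vertex \<open>w\<close> the pair \<open>K w n\<close>, \<open>x w n\<close> consists of the component containing \<open>w\<close> that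
  is left after \<open>n\<close> tree vertices have been deleted, and the next tree vertex in it (\<open>K w n\<close> is
  empty once \<open>w\<close> itself has been deleted). The next tree vertex is chosen on a shortest path to the
  element of least index of \<open>W\<close> in the component, so that this element is eventually reached.\<close>

locale normal_construction =
  fixes G :: "'a ugraph" and U W :: "'a set" and r :: 'a and idx :: "'a \<Rightarrow> nat"
  assumes simple: "simple_graph G" and connected: "connected_graph G"
    and U_W: "U \<subseteq> W" and W_V: "W \<subseteq> vertices G" and U_ne: "U \<noteq> {}"
    and r_V: "r \<in> vertices G" and inj_idx: "inj_on idx W"
begin

abbreviation "V \<equiv> vertices G"
abbreviation "E \<equiv> edges G"

section \<open>Deletion sequences and their components\<close>

definition comp :: "'a set \<Rightarrow> 'a \<Rightarrow> 'a \<Rightarrow> 'a set" where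
  "comp A y w = {v. conn E (A - {y}) w v}"

definition tgt :: "'a set \<Rightarrow> 'a" where
  "tgt A = arg_min idx (\<lambda>w. w \<in> W \<inter> A)"

definition dst :: "'a set \<Rightarrow> 'a \<Rightarrow> 'a \<Rightarrow> nat" where
  "dst A a b = (LEAST n. (a, b) \<in> adj E A ^^ n)"

text \<open>If \<open>A\<close> contains no element of \<open>W\<close>, the target is arbitrary,
  but the choice is still a neighbour of \<open>t\<close> in \<open>A\<close> whenever there is
  one.\<close>

definition pick :: "'a set \<Rightarrow> 'a \<Rightarrow> 'a" where
  "pick A t = arg_min (\<lambda>y. dst A y (tgt A)) (\<lambda>y. y \<in> A \<and> {t, y} \<in> E)"

primrec state :: "'a \<Rightarrow> nat \<Rightarrow> 'a set \<times> 'a" where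
  "state w 0 = (V, r)"
| "state w (Suc n) = (let A = comp (fst (state w n)) (snd (state w n)) w
                      in (A, pick A (snd (state w n))))"

definition "K w n = fst (state w n)"
definition "x w n = snd (state w n)"

lemma K_0 [simp]: "K w 0 = V" and x_0 [simp]: "x w 0 = r"
  by (simp_all add: K_def x_def)

lemma K_Suc: "K w (Suc n) = comp (K w n) (x w n) w"
  and x_Suc: "x w (Suc n) = pick (K w (Suc n)) (x w n)"
  by (simp_all add: K_def x_def Let_def)

lemma K_Suc_sub: "K w (Suc n) \<subseteq> K w n - {x w n}"
  using conn_right[of E "K w n - {x w n}" w] by (auto simp: K_Suc comp_def)

lemma K_Suc_edge:
  assumes "a \<in> K w (Suc n)" "{a, b} \<in> E" "b \<in> K w n - {x w n}"
  shows "b \<in> K w (Suc n)"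
proof -
  have c: "conn E (K w n - {x w n}) w a" using assms(1) by (simp add: K_Suc comp_def)
  from conn_trans[OF c conn_edge[OF assms(2) conn_right[OF c] assms(3)]]
  show ?thesis by (simp add: K_Suc comp_def)
qed

lemma K_antimono: "m \<le> n \<Longrightarrow> K w n \<subseteq> K w m"
  by (rule lift_Suc_antimono_le[of "K w"]) (use K_Suc_sub in auto)

lemma K_sub_V: "K w n \<subseteq> V"
  using K_antimono[of 0 n w] by simp

lemma K_connected:
  assumes "w \<in> V" "v \<in> K w n"
  shows "conn E (K w n) w v"
proof (cases n)
  case 0
  then show ?thesis using assms connected_graph_conn[OF connected] by simp
next
  case (Suc m)
  then show ?thesis using assms conn_inside[of E "K w m - {x w m}" w v] by (simp add: K_Suc comp_def)
qed

text \<open>Vertices that are still in the same component share the whole history of deletions. This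
  is what makes the sequences branch like a tree.\<close>

lemma K_cong:
  assumes "w \<in> V" "v \<in> K w n"
  shows "K v n = K w n" "x v n = x w n"
proof -
  have "K v n = K w n \<and> x v n = x w n"
    using assms(2)
  proof (induction n)
    case (Suc n)
    then have IH: "K v n = K w n" "x v n = x w n" using K_Suc_sub by auto
    have "conn E (K w n - {x w n}) w v" using Suc.prems by (simp add: K_Suc comp_def)
    then have "K v (Suc n) = K w (Suc n)"
      unfolding K_Suc comp_def IH using conn_trans conn_sym by fast
    then show ?case using IH by (simp add: x_Suc)
  qed simp
  then show "K v n = K w n" "x v n = x w n" by auto
qed

lemma pick_props:
  assumes "y \<in> A" "{t, y} \<in> E"
  shows "pick A t \<in> A" "{t, pick A t} \<in> E" "dst A (pick A t) (tgt A) \<le> dst A y (tgt A)"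
  using arg_min_nat_lemma[of "\<lambda>y. y \<in> A \<and> {t, y} \<in> E" y "\<lambda>y. dst A y (tgt A)"] assms
  unfolding pick_def by auto

lemma x_in:
  assumes "w \<in> K w n"
  shows "x w n \<in> K w n" and "n = Suc m \<Longrightarrow> {x w m, x w n} \<in> E"
proof -
  have wV: "w \<in> V" using assms K_sub_V by blast
  have "x w n \<in> K w n \<and> (\<forall>m. n = Suc m \<longrightarrow> {x w m, x w n} \<in> E)"
    using assms
  proof (induction n)
    case 0
    then show ?case using r_V by simp
  next
    case (Suc n)
    have w: "w \<in> K w n" "w \<noteq> x w n" using Suc.prems K_Suc_sub by auto
    then have c: "conn E (K w n) w (x w n)" using Suc.IH K_connected[OF wV] by simp
    \<comment> \<open>Otherwise the walk from \<open>w\<close> to \<open>x w n\<close> inside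
      \<open>K w n\<close> could never leave \<open>K w (Suc n)\<close>.\<close>
    have "\<exists>a\<in>K w (Suc n). {a, x w n} \<in> E"
    proof (rule ccontr)
      assume no: "\<not> ?thesis"
      have "x w n \<in> K w (Suc n)"
      proof (rule conn_closed[OF c Suc.prems])
        fix a b assume ab: "a \<in> K w (Suc n)" "b \<in> K w n" "{a, b} \<in> E"
        then have "b \<in> K w n - {x w n}" using no by blast
        then show "b \<in> K w (Suc n)" using K_Suc_edge ab by blast
      qed
      then show False using K_Suc_sub by blast
    qed
    then obtain a where a: "a \<in> K w (Suc n)" "{a, x w n} \<in> E" by blast
    then have "{x w n, a} \<in> E" by (simp add: insert_commute)
    then show ?case using pick_props(1,2)[OF a(1)] by (simp add: x_Suc)
  qed
  then show "x w n \<in> K w n" "n = Suc m \<Longrightarrow> {x w m, x w n} \<in> E" by auto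
qed

text \<open>Consider the step at which \<open>b\<close> is lost: since it is adjacent to the
  component that is kept, it must be the vertex deleted in that step.\<close>

lemma exit_K:
  assumes "a \<in> K w n" "b \<notin> K w n" "{a, b} \<in> E"
  shows "\<exists>i<n. b = x w i"
  using assms(1,2)
proof (induction n)
  case 0
  then show ?case using edge_in_vertices[OF simple assms(3)] by simp
next
  case (Suc n)
  show ?case
  proof (cases "b \<in> K w n")
    case True
    then have "b = x w n" using K_Suc_edge[OF Suc.prems(1) assms(3)] Suc.prems(2) by blast
    then show ?thesis by blast
  next
    case False
    then show ?thesis using Suc K_Suc_sub less_SucI by blast
  qed
qed

lemma tgt_props:
  assumes "w \<in> W" "w \<in> A"
  shows "tgt A \<in> W" "tgt A \<in> A" "idx (tgt A) \<le> idx w"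
  using arg_min_nat_lemma[of "\<lambda>w. w \<in> W \<inter> A" w idx] assms unfolding tgt_def by auto

text \<open>All vertices of the walk reach \<open>m\<close> in at most \<open>j\<close> steps, so
  none of them is \<open>x w n\<close>; the walk therefore survives the deletion inside the
  component of \<open>m\<close>.\<close>

lemma shortcut:
  assumes "(y, m) \<in> adj E (K w n) ^^ j" "\<And>i. i \<le> j \<Longrightarrow> (x w n, m) \<notin> adj E (K w n) ^^ i"
    and "m \<in> K w (Suc n)"
  shows "y \<in> K w (Suc n) \<and> (y, m) \<in> adj E (K w (Suc n)) ^^ j"
  using assms(1,2)
proof (induction j arbitrary: y)
  case 0
  then show ?case using assms(3) by simp
next
  case (Suc j)
  obtain z where z: "(y, z) \<in> adj E (K w n)" "(z, m) \<in> adj E (K w n) ^^ j"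
    using relpow_Suc_E2[OF Suc.prems(1)] by metis
  have IH: "z \<in> K w (Suc n)" "(z, m) \<in> adj E (K w (Suc n)) ^^ j"
    using Suc.IH[OF z(2)] Suc.prems(2) by auto
  have "y \<noteq> x w n" using Suc.prems by blast
  then have "y \<in> K w (Suc n)"
    using K_Suc_edge[OF IH(1), of y] z(1) by (simp add: adj_def insert_commute)
  then have "(y, z) \<in> adj E (K w (Suc n))" using z(1) IH(1) by (simp add: adj_def)
  then show ?case using \<open>y \<in> K w (Suc n)\<close> IH(2) relpow_Suc_I2 by metis
qed

lemma dst_relpow: "conn E A a b \<Longrightarrow> (a, b) \<in> adj E A ^^ dst A a b"
  unfolding dst_def by (rule LeastI_ex) (simp add: conn_def rtrancl_power)

text \<open>While \<open>w\<close> survives, the index of the target never decreases and is bounded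
  by \<open>idx w\<close>; while the target stays the same, the tree vertices get closer to
  it.\<close>

lemma K_terminates:
  assumes w: "w \<in> W"
  shows "\<exists>n. w \<notin> K w n"
proof (rule ccontr)
  assume "\<not> ?thesis"
  then have al: "w \<in> K w n" for n by blast
  have wV: "w \<in> V" using w W_V by blast
  define m where "m n = tgt (K w n)" for n
  have m: "m n \<in> W" "m n \<in> K w n" "idx (m n) \<le> idx w" for n
    using tgt_props[OF w al] by (auto simp: m_def)
  define \<mu> where "\<mu> n = (idx w - idx (m n), dst (K w n) (x w n) (m n))" for n
  have "(\<mu> (Suc n), \<mu> n) \<in> less_than <*lex*> less_than" for n
  proof -
    have mK: "m (Suc n) \<in> K w n - {x w n}" using m(2) K_Suc_sub by blast
    then have le: "idx (m n) \<le> idx (m (Suc n))"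
      using tgt_props(3)[OF m(1)[of "Suc n"]] unfolding m_def[of n] by blast
    show ?thesis
    proof (cases "idx (m n) = idx (m (Suc n))")
      case False
      then show ?thesis using le m(3)[of "Suc n"] by (auto simp: \<mu>_def)
    next
      case True
      then have eq: "m (Suc n) = m n" using inj_idx m(1) by (auto dest: inj_onD)
      have "conn E (K w n) (x w n) (m n)"
        using K_connected[OF wV] x_in(1)[OF al] m(2) conn_sym conn_trans by metis
      then have d: "(x w n, m n) \<in> adj E (K w n) ^^ dst (K w n) (x w n) (m n)" by (rule dst_relpow)
      \<comment> \<open>The target survives into the next component, whereas \<open>x w n\<close> is
        deleted.\<close>
      have "dst (K w n) (x w n) (m n) \<noteq> 0"
      proof
        assume "dst (K w n) (x w n) (m n) = 0"
        then have "x w n = m n" using d by simp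
        then show False using mK eq by simp
      qed
      then obtain j where j: "dst (K w n) (x w n) (m n) = Suc j" by (cases "dst (K w n) (x w n) (m n)") auto
      then obtain y where y: "(x w n, y) \<in> adj E (K w n)" "(y, m n) \<in> adj E (K w n) ^^ j"
        using relpow_Suc_E2 d by metis
      have "(x w n, m n) \<notin> adj E (K w n) ^^ i" if "i \<le> j" for i
      proof
        assume "(x w n, m n) \<in> adj E (K w n) ^^ i"
        then have "dst (K w n) (x w n) (m n) \<le> i" unfolding dst_def by (rule Least_le)
        then show False using j that by simp
      qed
      \<comment> \<open>The rest of a shortest path to the target survives, and \<open>pick\<close>
        does at least as well as its first vertex \<open>y\<close>.\<close>
      then have yK: "y \<in> K w (Suc n)" "(y, m n) \<in> adj E (K w (Suc n)) ^^ j"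
        using shortcut[OF y(2)] m(2)[of "Suc n"] eq by auto
      have "{x w n, y} \<in> E" using y(1) by (simp add: adj_def)
      from pick_props(3)[OF yK(1) this]
      have "dst (K w (Suc n)) (x w (Suc n)) (m n) \<le> dst (K w (Suc n)) y (m n)"
        using eq by (simp add: x_Suc m_def)
      also have "\<dots> \<le> j" unfolding dst_def by (rule Least_le) (rule yK(2))
      finally show ?thesis using j eq by (simp add: \<mu>_def)
    qed
  qed
  moreover have "wf (less_than <*lex*> less_than)" by blast
  ultimately show False using wf_no_infinite_down_chainE by blast
qed

section \<open>The tree of those deleted vertices whose component meets \<open>U\<close>\<close>

definition T :: "'a set" where
  "T = {t. \<exists>n. t \<in> K t n \<and> x t n = t \<and> K t n \<inter> U \<noteq> {}}"

definition depth :: "'a \<Rightarrow> nat" where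
  "depth t = (LEAST n. x t n = t)"

abbreviation Kn :: "'a \<Rightarrow> 'a set" where
  "Kn t \<equiv> K t (depth t)"

text \<open>After the deletion of \<open>t\<close> the values \<open>x t n\<close> are unspecified
  and might hit \<open>t\<close> again. The least hit is the genuine one, since a hit at
  \<open>m\<close> removes \<open>t\<close> from \<open>K t (Suc m)\<close>.\<close>

lemma depth_eq:
  assumes "t \<in> K t n" "x t n = t"
  shows "depth t = n"
  unfolding depth_def
proof (rule Least_equality)
  show "x t n = t" by (rule assms(2))
  fix m assume m: "x t m = t"
  show "n \<le> m"
  proof (rule ccontr)
    assume "\<not> n \<le> m"
    then have "K t n \<subseteq> K t (Suc m)" by (intro K_antimono) simp
    moreover have "t \<notin> K t (Suc m)" using K_Suc_sub[of t m] unfolding m by blast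
    ultimately show False using assms(1) by blast
  qed
qed

lemma T_props:
  assumes "t \<in> T"
  shows "t \<in> Kn t" "x t (depth t) = t" "Kn t \<inter> U \<noteq> {}" "t \<in> V"
proof -
  obtain n where n: "t \<in> K t n" "x t n = t" "K t n \<inter> U \<noteq> {}" using assms by (auto simp: T_def)
  then show "t \<in> Kn t" "x t (depth t) = t" "Kn t \<inter> U \<noteq> {}" "t \<in> V"
    using depth_eq[OF n(1,2)] K_sub_V by auto
qed

lemma x_T:
  assumes "w \<in> K w n" "K w n \<inter> U \<noteq> {}"
  shows "x w n \<in> T" "depth (x w n) = n" "Kn (x w n) = K w n"
    and "m \<le> n \<Longrightarrow> x (x w n) m = x w m"
proof -
  have w: "w \<in> V" using assms(1) K_sub_V by blast
  have xw: "x w n \<in> K w n" using x_in assms(1) by blast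
  note c = K_cong[OF w xw]
  have d: "depth (x w n) = n" using xw c by (intro depth_eq) auto
  then show "depth (x w n) = n" "Kn (x w n) = K w n" using c by auto
  show "x w n \<in> T" using c xw assms(2) by (auto simp: T_def)
  show "m \<le> n \<Longrightarrow> x (x w n) m = x w m"
    using K_cong(2)[OF w] xw K_antimono by blast
qed

lemma ancestor_T:
  assumes "t \<in> T" "i \<le> depth t"
  shows "x t i \<in> T" "depth (x t i) = i"
proof -
  have "t \<in> K t i" "K t i \<inter> U \<noteq> {}"
    using T_props[OF assms(1)] K_antimono[OF assms(2), of t] by auto
  then show "x t i \<in> T" "depth (x t i) = i" using x_T by auto
qed

definition pred :: "'a \<Rightarrow> 'a" where
  "pred t = x t (depth t - 1)"

lemma r_T: "r \<in> T" "depth r = 0"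
proof -
  have "r \<in> K r 0" "K r 0 \<inter> U \<noteq> {}" using r_V U_ne U_W W_V by auto
  then show "r \<in> T" "depth r = 0" using x_T(1,2)[of r 0] by auto
qed

lemma pred_props:
  assumes "t \<in> T" "t \<noteq> r"
  shows "depth t = Suc (depth (pred t))" "pred t \<in> T" "{pred t, t} \<in> E"
    and "m < depth t \<Longrightarrow> x (pred t) m = x t m"
proof -
  have "depth t \<noteq> 0" using T_props(2)[OF assms(1)] assms(2) by (auto intro: ccontr)
  then obtain m where m: "depth t = Suc m" by (cases "depth t") auto
  have t: "t \<in> K t m" "K t m \<inter> U \<noteq> {}"
    using T_props(1,3)[OF assms(1)] K_Suc_sub[of t m] m by auto
  have p: "pred t = x t m" by (simp add: pred_def m)
  show "depth t = Suc (depth (pred t))" "pred t \<in> T" using x_T(1,2)[OF t] by (simp_all add: p m)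
  show "{pred t, t} \<in> E" using x_in(2)[OF T_props(1)[OF assms(1)] m] T_props(2)[OF assms(1)] by (simp add: p)
  show "k < depth t \<Longrightarrow> x (pred t) k = x t k" for k using x_T(4)[OF t, of k] by (simp add: p m)
qed

text \<open>From here on \<open>par\<close>, \<open>down\<close> and \<open>tree\<close> belong to
  the tree on \<open>T\<close> with parent function \<open>pred\<close>.\<close>

sublocale ptree G T r pred depth
  using T_props(4) r_T pred_props by unfold_locales auto

lemma ancestor_le:
  assumes "t \<in> T" "n \<le> depth t"
  shows "x t n \<in> down t"
  using assms
proof (induction rule: level_induct)
  case base
  then show ?case using r_T by (simp add: down_root)
next
  case (step v)
  show ?case
  proof (cases "n = depth v")
    case True
    then show ?thesis using T_props(2)[OF step(1)] by (simp add: down_def)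
  next
    case False
    then have "x (pred v) n \<in> down (pred v)" "x (pred v) n = x v n"
      using step pred_props[OF step(1,2)] by auto
    then show ?thesis using down_step[OF step(1,2)] by simp
  qed
qed

lemma Kn_node: "w \<in> Kn t \<Longrightarrow> t \<in> T \<Longrightarrow> w \<in> K w (depth t) \<and> t = x w (depth t)"
  using K_cong[of t w "depth t"] T_props[of t] by simp

text \<open>By \<open>K_cong\<close>, \<open>s\<close> occurs in the sequence of \<open>t\<close> at
  a step where \<open>t\<close> is still present, hence no later than \<open>t\<close>
  itself.\<close>

lemma Kn_le:
  assumes "s \<in> T" "t \<in> T" "t \<in> Kn s"
  shows "s \<in> down t"
proof -
  have s: "t \<in> K t (depth s)" "s = x t (depth s)" using Kn_node[OF assms(3,1)] by auto
  have "depth s \<le> depth t"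
  proof (rule ccontr)
    assume "\<not> ?thesis"
    then have "K t (depth s) \<subseteq> K t (Suc (depth t))" by (intro K_antimono) simp
    then show False using s(1) K_Suc_sub[of t "depth t"] T_props(2)[OF assms(2)] by auto
  qed
  then show ?thesis using ancestor_le[OF assms(2)] s(2) by metis
qed

text \<open>An edge can leave \<open>Kn t\<close> only towards a vertex deleted earlier in the
  sequence of \<open>t\<close>, that is, an ancestor. Normality rests on this.\<close>

lemma exit_Kn:
  assumes "t \<in> T" "a \<in> Kn t" "b \<notin> Kn t" "{a, b} \<in> E"
  shows "b \<in> T" "b \<in> down t"
proof -
  obtain i where "i < depth t" "b = x t i" using exit_K[OF assms(2-4)] by blast
  then show "b \<in> T" "b \<in> down t" using ancestor_T(1)[OF assms(1)] ancestor_le[OF assms(1)] by auto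
qed

text \<open>Such \<open>t\<close> are entries of the sequence of \<open>w\<close> from before the
  deletion of \<open>w\<close>, which happens after finitely many steps.\<close>

lemma finite_Kn:
  assumes "w \<in> W"
  shows "finite {t \<in> T. w \<in> Kn t}"
proof -
  obtain N where N: "w \<notin> K w N" using K_terminates[OF assms] by blast
  have "{t \<in> T. w \<in> Kn t} \<subseteq> x w ` {..<N}"
  proof
    fix t assume "t \<in> {t \<in> T. w \<in> Kn t}"
    then have t: "w \<in> K w (depth t)" "t = x w (depth t)" using Kn_node by auto
    have "depth t < N" using t(1) N K_antimono[of N "depth t" w] by (meson not_le subsetD)
    then show "t \<in> x w ` {..<N}" using t(2) by blast
  qed
  then show ?thesis using finite_subset by blast
qed

text \<open>The component followed for \<open>u\<close> can lose \<open>u\<close> only by deleting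
  it.\<close>

lemma U_T: "U \<subseteq> T"
proof
  fix u assume u: "u \<in> U"
  then have "\<exists>n. u \<notin> K u n" using K_terminates U_W by blast
  moreover have "u \<in> K u 0" using u U_W W_V by auto
  ultimately obtain n where n: "u \<in> K u n" "u \<notin> K u (Suc n)" using nat_induct[of "\<lambda>n. u \<in> K u n"] by blast
  have "x u n = u"
  proof (rule ccontr)
    assume "x u n \<noteq> u"
    then have "u \<in> K u (Suc n)" using n(1) by (auto simp: K_Suc comp_def intro: conn_refl)
    then show False using n(2) by blast
  qed
  then show "u \<in> T" using n(1) u by (auto simp: T_def)
qed

lemma U_above:
  assumes "t \<in> T"
  shows "\<exists>u\<in>U. (t, u) \<in> par\<^sup>*"
  using T_props(3)[OF assms] Kn_le[OF assms] U_T unfolding down_def by blast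

lemma cofinal: "contains_cofinally tree r U"
  using U_T U_above tree_leI unfolding contains_cofinally_def down_def vertices_tree by blast

text \<open>For incomparable ends \<open>s\<close> and \<open>t\<close>, the path could leave
  \<open>Kn s\<close> only at a vertex of \<open>T\<close> strictly below \<open>s\<close>, but
  \<open>s\<close> and \<open>t\<close> are its only vertices in \<open>T\<close>. So
  \<open>t \<in> Kn s\<close>, whence \<open>s\<close> lies below \<open>t\<close>.\<close>

lemma normal: "normal_tree_in G tree r"
  unfolding normal_tree_in_def
proof (intro conjI allI impI rooted_tree tree_subgraph)
  fix p assume p: "X_path G (vertices tree) p"
  define s t where "s = hd p" "t = last p"
  have st: "s \<in> T" "t \<in> T" using p by (auto simp: X_path_def s_t_def)
  have "distinct p" "2 \<le> length p" using p by (auto simp: X_path_def path_in_def)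
  then have inner: "set p \<inter> T \<subseteq> {s, t}"
    using p inner_vertices_eq[of p] by (auto simp: X_path_def s_t_def)
  have "s \<in> down t \<or> t \<in> down s"
  proof (rule ccontr)
    assume no: "\<not> ?thesis"
    have "conn E (set p) s t"
      using path_conn_hd[of G p "set p" t] p last_in_set[of p]
      by (auto simp: X_path_def path_in_def s_t_def)
    then have "t \<in> Kn s"
    proof (rule conn_closed)
      show "s \<in> Kn s" using T_props st by blast
      fix a b assume ab: "a \<in> Kn s" "b \<in> set p" "{a, b} \<in> E"
      show "b \<in> Kn s"
      proof (rule ccontr)
        assume b: "b \<notin> Kn s"
        then have "b = s \<or> b = t" using exit_Kn(1)[OF st(1) ab(1) b ab(3)] ab(2) inner by blast
        then show False using exit_Kn(2)[OF st(1) ab(1) b ab(3)] no b T_props(1)[OF st(1)] by blast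
      qed
    qed
    then show False using Kn_le st no by blast
  qed
  then show "tree_le tree r (hd p) (last p) \<or> tree_le tree r (last p) (hd p)"
    using tree_leI st by (auto simp: s_t_def)
qed

text \<open>Every vertex of \<open>T\<close> lies below an element of \<open>U\<close>. So all
  children are live, and every ray of the tree is tied to \<open>U\<close>.\<close>

lemma undominated_tree:
  assumes "\<not> has_star_attached_to G U"
  shows "undominated_normal_tree G U tree r"
  unfolding undominated_normal_tree_def
proof (intro conjI allI impI normal)
  have no: "\<not> linked G v U" for v using assms linked_imp_star[OF simple] by blast
  show "U \<subseteq> vertices tree" using U_T by simp
  show "locally_finite tree"
    unfolding locally_finite_def
  proof
    fix v assume "v \<in> vertices tree"
    then have "finite (live U v)" using linked_if_infinite_live no by auto
    moreover have "{c. (v, c) \<in> par} \<subseteq> live U v"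
      using U_above par_props(2) unfolding live_def by blast
    ultimately show "finite (nbhd tree v)"
      using nbhd_tree[of v] by (meson finite_insert finite_subset)
  qed
  fix R assume "ray_in tree R"
  then have "tied G (range R) U" using U_above by (intro tied_above) (auto simp: ray_in_def)
  then show "undominated G R"
    using no tied_linked[OF _ dominates_imp_linked] unfolding undominated_def by metis
qed

lemma finite_neighbours:
  assumes env: "\<And>d. d \<in> V - W \<Longrightarrow> finite {y \<in> W. \<exists>c. conn E (- W) d c \<and> {c, y} \<in> E}"
    and D: "D \<noteq> {}" "D \<subseteq> V - T" "\<And>a b. a \<in> D \<Longrightarrow> b \<in> D \<Longrightarrow> conn E D a b"
  shows "finite {y \<in> T. \<exists>d\<in>D. {y, d} \<in> E}"
proof (rule ccontr)
  define N where "N = {y \<in> T. \<exists>d\<in>D. {y, d} \<in> E}"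
  assume "\<not> ?thesis"
  then have inf: "infinite N" by (simp add: N_def)
  \<comment> \<open>\<open>D\<close> is connected and avoids \<open>T\<close>, while
    \<open>Kn y\<close> can be left only through \<open>T\<close>.\<close>
  have DK: "D \<subseteq> Kn y" if y: "y \<in> N" for y
  proof
    fix v assume v: "v \<in> D"
    obtain d where d: "y \<in> T" "d \<in> D" "{y, d} \<in> E" using y by (auto simp: N_def)
    have "d \<in> Kn y" using exit_Kn(1)[OF d(1) T_props(1)[OF d(1)] _ d(3)] d(2) D(2) by blast
    show "v \<in> Kn y"
    proof (rule conn_closed[OF D(3)[OF d(2) v] \<open>d \<in> Kn y\<close>])
      fix a b assume "a \<in> Kn y" "b \<in> D" "{a, b} \<in> E"
      then show "b \<in> Kn y" using exit_Kn(1)[OF d(1)] D(2) by blast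
    qed
  qed
  \<comment> \<open>An element of \<open>W\<close> in \<open>D\<close> would lie in
    \<open>Kn y\<close> for infinitely many \<open>y\<close>.\<close>
  have DW: "w \<notin> D" if "w \<in> W" for w
  proof
    assume "w \<in> D"
    then have "N \<subseteq> {t \<in> T. w \<in> Kn t}" using DK by (auto simp: N_def)
    then show False using finite_Kn[OF that] inf finite_subset by blast
  qed
  obtain d where d: "d \<in> D" using D(1) by blast
  define F where "F = {y \<in> W. \<exists>c. conn E (- W) d c \<and> {c, y} \<in> E}"
  have "d \<in> V - W" using d DW D(2) by blast
  then have "finite F" unfolding F_def by (rule env)
  then have "finite (\<Union>w\<in>F. {t \<in> T. w \<in> Kn t})" using finite_Kn by (auto simp: F_def)
  \<comment> \<open>Each \<open>w \<in> F\<close> lies in only finitely many sets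
    \<open>Kn t\<close>, so some \<open>y \<in> N\<close> has \<open>Kn y\<close> disjoint from
    \<open>F\<close>.\<close>
  then have "\<not> N \<subseteq> (\<Union>w\<in>F. {t \<in> T. w \<in> Kn t})" using inf finite_subset by blast
  then obtain y where y: "y \<in> N" "F \<inter> Kn y = {}" by (auto simp: N_def)
  have yT: "y \<in> T" using y(1) by (simp add: N_def)
  obtain u where u: "u \<in> U" "u \<in> Kn y" using T_props(3)[OF yT] by blast
  have "conn E (Kn y) d u"
    using K_connected[OF T_props(4)[OF yT]] u(2) DK[OF y(1)] d conn_sym conn_trans by (meson subsetD)
  \<comment> \<open>A walk in \<open>Kn y\<close> cannot leave the component of \<open>d\<close> in
    \<open>G - W\<close>, since it would have to enter \<open>F\<close>. But \<open>u\<close> is in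
    \<open>W\<close>.\<close>
  then have "u \<in> {c. conn E (- W) d c}"
  proof (rule conn_closed)
    show "d \<in> {c. conn E (- W) d c}" using \<open>d \<in> V - W\<close> by (simp add: conn_refl)
    fix a b assume ab: "a \<in> {c. conn E (- W) d c}" "b \<in> Kn y" "{a, b} \<in> E"
    then have "b \<notin> W" using y(2) by (auto simp: F_def)
    then have "conn E (- W) a b" using ab conn_right[of E "- W" d a] by (intro conn_edge) auto
    then show "b \<in> {c. conn E (- W) d c}" using ab(1) conn_trans by fast
  qed
  then show False using conn_right[of E "- W" d u] u(1) U_W by blast
qed

end

section \<open>Components and the duality theorem\<close>

lemma component_props:
  assumes G: "simple_graph G" and D: "is_component D (delete_vertices G X)"
  shows "vertices D \<noteq> {}" "vertices D \<subseteq> vertices G - X"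
    "\<And>a b. a \<in> vertices D \<Longrightarrow> b \<in> vertices D \<Longrightarrow> conn (edges G) (vertices D) a b"
    "neighbourhood G D \<subseteq> X"
proof -
  have sub: "is_subgraph D (delete_vertices G X)" and con: "connected_graph D"
    using D by (auto simp: is_component_def)
  then have simp: "simple_graph D" and V: "vertices D \<subseteq> vertices G - X" and E: "edges D \<subseteq> edges G"
    by (auto simp: is_subgraph_def delete_vertices_def)
  show "vertices D \<noteq> {}" using con by (simp add: connected_graph_def)
  show "vertices D \<subseteq> vertices G - X" by (rule V)
  show "conn (edges G) (vertices D) a b" if "a \<in> vertices D" "b \<in> vertices D" for a b
    using conn_mono[OF connected_graph_conn[OF con that] order_refl E] .
  show "neighbourhood G D \<subseteq> X"
  proof (rule subsetI, rule ccontr)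
    fix v assume "v \<in> neighbourhood G D" and vX: "v \<notin> X"
    then obtain u where u: "v \<in> vertices G" "v \<notin> vertices D" "u \<in> vertices D" "{v, u} \<in> edges G"
      by (auto simp: neighbourhood_def)
    \<comment> \<open>\<open>D\<close> together with \<open>v\<close> and the edge to
      \<open>u\<close> is still connected and avoids \<open>X\<close>, against the maximality of the
      component \<open>D\<close>.\<close>
    define D' where "D' = Graph (insert v (vertices D)) (insert {v, u} (edges D))"
    have "simple_graph D'"
      unfolding simple_graph_def
    proof
      fix e assume "e \<in> edges D'"
      then consider "e = {v, u}" | "e \<in> edges D" by (auto simp: D'_def)
      then show "\<exists>a\<in>vertices D'. \<exists>b\<in>vertices D'. a \<noteq> b \<and> e = {a, b}"
      proof cases
        case 1
        then show ?thesis
          using edge_in_vertices(3)[OF G u(4)] u(3)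
          by (intro bexI[of _ v] bexI[of _ u]) (simp_all add: D'_def)
      next
        case 2
        then obtain a b where "a \<in> vertices D" "b \<in> vertices D" "a \<noteq> b" "e = {a, b}"
          using simp unfolding simple_graph_def by blast
        then show ?thesis by (intro bexI[of _ a] bexI[of _ b]) (simp_all add: D'_def)
      qed
    qed
    moreover have "edges D \<subseteq> edges (delete_vertices G X)" using sub by (simp add: is_subgraph_def)
    ultimately have sub': "is_subgraph D' (delete_vertices G X)"
      using u V vX by (auto simp: is_subgraph_def D'_def delete_vertices_def)
    have *: "conn (edges D') UNIV u b" if "b \<in> vertices D'" for b
    proof (cases "b = v")
      case True
      then show ?thesis by (auto simp: D'_def insert_commute intro!: conn_edge)
    next
      case False
      then have "conn (edges D) (vertices D) u b"
        using connected_graph_conn[OF con u(3)] that by (simp add: D'_def)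
      then show ?thesis by (rule conn_mono) (auto simp: D'_def)
    qed
    have "connected_graph D'"
      unfolding connected_graph_def
    proof (intro conjI ballI)
      show "vertices D' \<noteq> {}" by (simp add: D'_def)
      fix a b assume "a \<in> vertices D'" "b \<in> vertices D'"
      then show "\<exists>p. path_in D' p \<and> hd p = a \<and> last p = b"
        using conn_imp_path[OF \<open>simple_graph D'\<close> _ conn_trans[OF conn_sym[OF *] *]] by blast
    qed
    moreover have "is_subgraph D D'" using simp by (auto simp: is_subgraph_def D'_def)
    ultimately have "D' = D" using D sub' unfolding is_component_def by blast
    then show False using u(2) by (metis D'_def insertI1 ugraph.sel(1))
  qed
qed

text \<open>The envelope \<open>W\<close> and an enumeration of it are fed into the construction;
  \<open>U \<noteq> {}\<close> puts the root into \<open>T\<close>.\<close>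

lemma normal_tree_exists:
  assumes G: "simple_graph G" "connected_graph G" and U: "U \<subseteq> vertices G" "U \<noteq> {}"
    and no: "\<not> has_star_attached_to G U"
  shows "\<exists>T r. undominated_normal_tree G U T r \<and> contains_cofinally T r U \<and>
    (\<forall>C. is_component C (delete_vertices G (vertices T)) \<longrightarrow> finite (neighbourhood G C))"
proof -
  obtain W where W: "U \<subseteq> W" "W \<subseteq> vertices G" "countable W"
    "\<forall>d\<in>vertices G - W.
       finite {y \<in> W. \<exists>c. conn (edges G) (- W) d c \<and> {c, y} \<in> edges G}"
    by (rule envelope[OF G U(1) no])
  obtain idx :: "'a \<Rightarrow> nat" where idx: "inj_on idx W" using W(3) by (auto simp: countable_def)
  obtain r where r: "r \<in> vertices G" using U by blast
  interpret normal_construction G U W r idx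
    by unfold_locales (fact G W(1,2) U(2) r idx)+
  have "finite (neighbourhood G C)" if "is_component C (delete_vertices G (vertices tree))" for C
  proof -
    note C = component_props[OF G(1) that, unfolded vertices_tree]
    have "finite {y \<in> T. \<exists>d\<in>vertices C. {y, d} \<in> edges G}"
      by (rule finite_neighbours[OF bspec[OF W(4)] C(1-3)])
    moreover have "neighbourhood G C \<subseteq> {y \<in> T. \<exists>d\<in>vertices C. {y, d} \<in> edges G}"
      using C(4) by (auto simp: neighbourhood_def)
    ultimately show ?thesis by (rule rev_finite_subset)
  qed
  then show ?thesis using undominated_tree[OF no] cofinal by blast
qed

text \<open>Cofinality is stated for nonempty \<open>U\<close>, because a tree has a vertex and the
  empty set has no element above it.\<close>

theorem theorem6:
  fixes G :: "'a ugraph" and U :: "'a set"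
  assumes "simple_graph G" and "connected_graph G" and "U \<subseteq> vertices G"
  shows "(has_star_attached_to G U \<or> (\<exists>T r. undominated_normal_tree G U T r)) \<and>
         \<not> (has_star_attached_to G U \<and> (\<exists>T r. undominated_normal_tree G U T r)) \<and>
         ((\<exists>T r. undominated_normal_tree G U T r) \<longrightarrow>
          (\<exists>T r. undominated_normal_tree G U T r \<and>
             (U \<noteq> {} \<longrightarrow> contains_cofinally T r U) \<and>
             (\<forall>C. is_component C (delete_vertices G (vertices T)) \<longrightarrow>
                finite (neighbourhood G C))))"
proof (cases "has_star_attached_to G U")
  case True
  have "\<not> undominated_normal_tree G U T r" for T r
  proof
    assume T: "undominated_normal_tree G U T r"
    show False
      by (rule star_excludes_tree[OF assms(1) _ _ _ _ _ True, of T])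
        (use T in \<open>auto simp: undominated_normal_tree_def normal_tree_in_def is_rooted_tree_def is_tree_def\<close>)
  qed
  then show ?thesis using True by blast
next
  case False
  have "\<exists>T r. undominated_normal_tree G U T r \<and> (U \<noteq> {} \<longrightarrow> contains_cofinally T r U) \<and>
    (\<forall>C. is_component C (delete_vertices G (vertices T)) \<longrightarrow> finite (neighbourhood G C))"
  proof (cases "U = {}")
    case True
    obtain r where r: "r \<in> vertices G" using assms(2) by (auto simp: connected_graph_def)
    \<comment> \<open>For empty \<open>U\<close> the tree is built for a single vertex; no star is
      attached to a finite set.\<close>
    have "\<not> has_star_attached_to G {r}" 
      using star_imp_linked[of G "{r}"] finite_not_linked[of "{r}" G] by auto
    then obtain T r' where "undominated_normal_tree G {r} T r'"
      "\<forall>C. is_component C (delete_vertices G (vertices T)) \<longrightarrow> finite (neighbourhood G C)"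
      using normal_tree_exists[OF assms(1,2), of "{r}"] r by auto
    then show ?thesis using True unfolding undominated_normal_tree_def by blast
  next
    case False
    then show ?thesis using normal_tree_exists[OF assms] \<open>\<not> has_star_attached_to G U\<close> by blast
  qed
  then show ?thesis using False by blast
qed

end
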